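(* For every integer $b\geq 2$, there exist infinitely many square-free palindromes in base $b$.
   Context: Fix an integer base $b\ge 2$. A positive integer $n$ with base-$b$ expansion $n=\sum_{0\le i<N} n_i b^i$, $0\le n_i<b$, $n_{N-1}\neq 0$ and $n_0\neq 0$, has digital reverse $\overleftarrow{n}=\sum_{0\le i<N} n_i b^{N-1-i}$. A palindrome in base $b$ is an integer $n\geq 0$ with $b\nmid n$ and $n=\overleftarrow{n}$ (the condition $b\nmid n$ says that the last digit $n_0$ is non-zero). A square-free number is a positive integer with no repeated prime factors. *)

theory Defs
  imports "HOL-Computational_Algebra.Squarefree"
begin

definition digit :: "nat \<Rightarrow> nat \<Rightarrow> nat \<Rightarrow> nat" where
  "digit b n i = n div b ^ i mod b"

definition num_digits :: "nat \<Rightarrow> nat \<Rightarrow> nat" where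
  "num_digits b n = (LEAST N. n < b ^ N)"

(* Total on nat; it is the digital reverse of a positive n only when b does not divide n. *)
definition digit_reverse :: "nat \<Rightarrow> nat \<Rightarrow> nat" where
  "digit_reverse b n = (\<Sum>i<num_digits b n. digit b n i * b ^ (num_digits b n - 1 - i))"

definition palindrome :: "nat \<Rightarrow> nat \<Rightarrow> bool" where
  "palindrome b n \<longleftrightarrow> \<not> b dvd n \<and> n = digit_reverse b n"

text \<open>The digits above are those of the base-\<open>b\<close> expansion with non-zero leading digit,
  and that expansion is unique.\<close>

lemma digit_less: "b \<ge> 2 \<Longrightarrow> digit b n i < b"
  by (simp add: digit_def)

lemma digit_0: "digit b n 0 = 0 \<longleftrightarrow> b dvd n"
  by (simp add: digit_def dvd_eq_mod_eq_0)

lemma less_power_num_digits: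
  assumes "b \<ge> 2" shows "n < b ^ num_digits b n"
proof -
  have "n < b ^ n"
    using assms by (simp add: power_gt_expt)
  then show ?thesis
    unfolding num_digits_def by (rule LeastI)
qed

lemma sum_digits_mod: "(\<Sum>i<N. digit b n i * b ^ i) = n mod b ^ N"
proof (induction N)
  case (Suc N)
  have "n mod b ^ Suc N = b ^ N * (n div b ^ N mod b) + n mod b ^ N"
    unfolding power_Suc2 by (rule mod_mult2_eq)
  with Suc show ?case
    by (simp add: digit_def)
qed simp

lemma sum_digits:
  assumes "b \<ge> 2"
  shows "(\<Sum>i<num_digits b n. digit b n i * b ^ i) = n"
  using less_power_num_digits[OF assms] by (simp add: sum_digits_mod)

lemma leading_digit_nonzero:
  assumes "b \<ge> 2" "n > 0"
  shows "num_digits b n > 0" "digit b n (num_digits b n - 1) \<noteq> 0"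
proof -
  show pos: "num_digits b n > 0"
    using less_power_num_digits[OF assms(1), of n] assms(2) by (cases "num_digits b n") auto
  define M where "M = num_digits b n - 1"
  have M: "num_digits b n = Suc M"
    using pos by (simp add: M_def)
  have "\<not> n < b ^ M"
  proof
    assume "n < b ^ M"
    then have "num_digits b n \<le> M"
      unfolding num_digits_def by (rule Least_le)
    with M show False by simp
  qed
  moreover have "n < b ^ M * b"
    using less_power_num_digits[OF assms(1), of n] M by (simp add: mult.commute)
  then have "n div b ^ M < b"
    by (simp add: less_mult_imp_div_less mult.commute)
  ultimately have "digit b n M \<noteq> 0"
    using assms(1) by (simp add: digit_def div_eq_0_iff)
  then show "digit b n (num_digits b n - 1) \<noteq> 0"
    by (simp add: M_def)
qed

lemma expansion_less:
  assumes "\<And>i. i < N \<Longrightarrow> d i < (b::nat)"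
  shows "(\<Sum>i<N. d i * b ^ i) < b ^ N"
  using assms
proof (induction N)
  case (Suc N)
  then have "(\<Sum>i<N. d i * b ^ i) < b ^ N" by simp
  moreover have "Suc (d N) * b ^ N \<le> b * b ^ N"
    using Suc.prems[of N] by (intro mult_right_mono) auto
  ultimately show ?case by simp
qed simp

lemma digit_expansion:
  assumes "\<And>i. i < N \<Longrightarrow> d i < (b::nat)" "k < N"
  shows "digit b (\<Sum>i<N. d i * b ^ i) k = d k"
  using assms
proof (induction N)
  case (Suc N)
  let ?s = "\<Sum>i<N. d i * b ^ i"
  have b: "b > 0" using Suc.prems(1)[of N] by simp
  show ?case
  proof (cases "k = N")
    case True
    have "?s < b ^ N" using Suc.prems(1) by (intro expansion_less) simp
    then show ?thesis using True b Suc.prems(1)[of N] by (simp add: digit_def)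
  next
    case False
    with Suc.prems have k: "k < N" by simp
    then obtain m where m: "N = Suc (k + m)" using less_imp_Suc_add by blast
    have "?s + d N * b ^ N = ?s + b ^ k * (b * (d N * b ^ m))"
      by (simp add: m power_add mult_ac)
    then have "(?s + d N * b ^ N) div b ^ k = ?s div b ^ k + b * (d N * b ^ m)"
      using b by (simp only:) simp
    then have "digit b (?s + d N * b ^ N) k = digit b ?s k"
      by (simp add: digit_def)
    then show ?thesis using Suc k by simp
  qed
qed simp

lemma num_digits_expansion:
  assumes "b \<ge> 2" "\<And>i. i < N \<Longrightarrow> d i < b" "N > 0" "d (N - 1) \<noteq> 0"
  shows "num_digits b (\<Sum>i<N. d i * b ^ i) = N"
  unfolding num_digits_def
proof (rule Least_equality)
  show "(\<Sum>i<N. d i * b ^ i) < b ^ N" using assms(2) by (rule expansion_less)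
next
  fix M assume M: "(\<Sum>i<N. d i * b ^ i) < b ^ M"
  have "b ^ (N - 1) \<le> d (N - 1) * b ^ (N - 1)" using assms(4) by simp
  also have "\<dots> \<le> (\<Sum>i<N. d i * b ^ i)"
    using assms(3) by (intro member_le_sum) auto
  finally have "b ^ (N - 1) < b ^ M" using M by simp
  then have "N - 1 < M" using assms(1) by (simp add: power_strict_increasing_iff)
  then show "N \<le> M" by simp
qed

end

theory Submission
  imports Defs Complex_Main "HOL-Number_Theory.Residues"
begin

text \<open>
  Consider the palindromes \<open>n = a + b\<^sup>h + b\<^sup>h\<^sup>+\<^sup>1 rev(a)\<close> with \<open>2h + 1\<close> digits, middle digit \<open>1\<close> and lower
  half \<open>a < b\<^sup>h\<close> ending in the digit \<open>1\<close>. There are \<open>b\<^sup>h\<^sup>-\<^sup>1\<close> of them, they have size about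
  \<open>X = b\<^sup>2\<^sup>h\<close>, and all are odd and coprime to \<open>b\<close>. So a square \<open>d\<^sup>2 > 1\<close> can divide \<open>n\<close> only if
  \<open>d \<ge> 3\<close> is odd and coprime to \<open>b\<close>, and it suffices that the sum over these \<open>d\<close> of the proportion of
  \<open>n\<close> divisible by \<open>d\<^sup>2\<close> is below \<open>1\<close> for suitable large \<open>h\<close>. Three ranges of \<open>d\<close> need
  different arguments.

  \<^emph>\<open>Bounded \<open>d\<close>.\<close> For a fixed odd modulus \<open>q\<close> coprime to \<open>b\<close> the palindromes are equidistributed
  modulo \<open>q\<close>, so the proportion tends to \<open>1 / d\<^sup>2\<close>, and these numbers add up to at most \<open>1 / 2\<close>
  for \<open>d \<ge> 3\<close>. The reason (\<open>pal_equidistributed\<close>) is that adding a long block of outer digits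
  averages the distribution over all shifts, hence contracts its maximum towards \<open>1 / q\<close>.

  \<^emph>\<open>Large \<open>d\<close>, from about \<open>X\<^sup>1\<^sup>/\<^sup>3\<close> on.\<close> Write \<open>n = d\<^sup>2 m\<close> with \<open>b\<^sup>s \<le> d < b\<^sup>s\<^sup>+\<^sup>1\<close>. The residue of
  \<open>d\<close> modulo \<open>b\<^sup>L\<close> and \<open>m\<close> give the last \<open>L\<close> digits of \<open>n\<close>, hence, \<open>n\<close> being a palindrome, its
  first \<open>L\<close> digits. So \<open>d\<^sup>2 = n / m\<close> is known up to a factor \<open>1 + O(b\<^sup>-\<^sup>L)\<close>, and \<open>d\<close> lies in an interval of
  length \<open>O(b\<^sup>s\<^sup>-\<^sup>L)\<close>. As its residue modulo \<open>b\<^sup>L\<close> is known as well, \<open>d\<close> is determined once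
  \<open>2L\<close> exceeds \<open>s\<close> by a constant. This leaves \<open>O(b\<^sup>L X / b\<^sup>2\<^sup>s)\<close>, about \<open>X / d\<^sup>3\<^sup>/\<^sup>2\<close>, possibilities
  (\<open>sum_card_square_divisors_large\<close>).

  \<^emph>\<open>Medium \<open>d\<close>.\<close> Given all other digits, at most one choice of the central \<open>2s - 1\<close> digits makes \<open>n\<close>
  divisible by \<open>d\<^sup>2\<close>. This yields only the proportion \<open>O(1 / d)\<close>, whose sum over \<open>d\<close> diverges. To save a
  power of \<open>d\<close>, let further digits vary, \<open>3g\<close> of them in each half with \<open>g\<close> about \<open>s / 14\<close>, and sort the
  solutions into \<open>b\<^sup>2\<^sup>g\<close> classes according to the outermost \<open>2g\<close> of the \<open>s - 1\<close> central digits of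
  the lower half. The number of solutions is at most the number of classes plus the number of pairs in a
  common class (\<open>card_le_classes_plus_pairs\<close>). The difference of the two members of a pair is
  divisible by \<open>d\<^sup>2\<close> and no longer involves the outer digits; the two blocks of \<open>3g\<close> digits determine it up to a
  small relative error, and they determine its residue modulo \<open>b\<^sup>7\<^sup>g\<close>. Exactly as for
  large \<open>d\<close>, its size and its residue modulo \<open>b\<^sup>7\<^sup>g\<close> leave room for few \<open>d\<close> (\<open>card_near_square_divisors\<close>). On average over \<open>d\<close> the
  \<open>b\<^sup>3\<^sup>g\<close> conceivable solutions shrink to \<open>O(b\<^sup>2\<^sup>g)\<close>
  (\<open>sum_card_square_divisors_middle\<close>), and the resulting bound \<open>O(b\<^sup>-\<^sup>g)\<close> can be summed over \<open>s\<close>.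

  The argument for medium \<open>d\<close> requires roughly \<open>s + 5g \<le> h\<close>, that is \<open>19 s / 14 \<le> h\<close>, and the one for
  large \<open>d\<close> requires \<open>s\<close> to exceed \<open>2h / 3\<close>; as \<open>14 / 19 > 2 / 3\<close>, the two ranges overlap. Taking \<open>h = 19w\<close>, they are separated at
  \<open>s = 14w\<close>.
\<close>

section \<open>Palindromes with a given lower half\<close>

text \<open>The reversal of exactly \<open>k\<close> digits, leading zeros included; unlike the reversal of a number this is
  compatible with splitting off blocks of digits.\<close>

definition rev_digits :: "nat \<Rightarrow> nat \<Rightarrow> nat \<Rightarrow> nat" where
  "rev_digits b k a = (\<Sum>i<k. digit b a i * b ^ (k - Suc i))"

text \<open>The number with \<open>2h + 1\<close> digits whose lower half is \<open>a\<close>, whose middle digit is \<open>1\<close>, and whose upper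
  half mirrors \<open>a\<close>. For odd \<open>b\<close> the two halves together contribute an even
  number, so the middle digit \<open>1\<close> makes the palindrome odd.\<close>

definition pal :: "nat \<Rightarrow> nat \<Rightarrow> nat \<Rightarrow> nat" where
  "pal b h a = a + b ^ h + b ^ Suc h * rev_digits b h a"

lemma rev_digits_as_expansion: "rev_digits b k a = (\<Sum>i<k. digit b a (k - Suc i) * b ^ i)"
proof -
  have "(\<Sum>i<k. digit b a (k - Suc i) * b ^ i) = (\<Sum>i<k. digit b a i * b ^ (k - Suc i))"
    by (subst sum.nat_diff_reindex [symmetric]) (auto intro!: sum.cong)
  then show ?thesis by (simp add: rev_digits_def)
qed

lemma sum_lessThan_add:
  "(\<Sum>i<k + l. f i) = (\<Sum>i<k. f i) + (\<Sum>i<l. f (k + i :: nat) :: nat)"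
  by (induction l) (simp_all add: add.assoc)

context
  fixes b :: nat
  assumes b2: "b \<ge> 2"
begin

lemma rev_digits_less: "rev_digits b k a < b ^ k"
  unfolding rev_digits_as_expansion using b2 by (intro expansion_less) (simp add: digit_less)

lemma rev_digits_inj:
  assumes "a < b ^ k" "a' < b ^ k" "rev_digits b k a = rev_digits b k a'"
  shows "a = a'"
proof -
  have "digit b a i = digit b a' i" if "i < k" for i
  proof -
    have "digit b (rev_digits b k c) (k - Suc i) = digit b c i" for c
      unfolding rev_digits_as_expansion using that b2
      by (subst digit_expansion) (auto simp: digit_less)
    with assms(3) show ?thesis by metis
  qed
  then have "a mod b ^ k = a' mod b ^ k"
    unfolding sum_digits_mod [symmetric] by simp
  with assms show ?thesis by simp
qed

lemma digit_append_low:
  assumes "a < b ^ k" "i < k"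
  shows "digit b (a + b ^ k * x) i = digit b a i"
proof -
  obtain m where m: "k = Suc (i + m)" using less_imp_Suc_add[OF assms(2)] by blast
  have "a + b ^ k * x = a + b ^ i * (b * (b ^ m * x))"
    by (simp add: m power_add mult_ac)
  then have "(a + b ^ k * x) div b ^ i = a div b ^ i + b * (b ^ m * x)"
    using b2 by (simp only:) simp
  then show ?thesis by (simp add: digit_def)
qed

lemma digit_append_high:
  assumes "a < b ^ k"
  shows "digit b (a + b ^ k * x) (k + i) = digit b x i"
  using assms b2 by (simp add: digit_def power_add div_mult2_eq)

lemma rev_digits_append:
  assumes "a < b ^ k"
  shows "rev_digits b (k + l) (a + b ^ k * x) = b ^ l * rev_digits b k a + rev_digits b l x"
proof -
  have "rev_digits b (k + l) (a + b ^ k * x) =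
      (\<Sum>i<k. digit b (a + b ^ k * x) i * b ^ (k + l - Suc i)) +
      (\<Sum>i<l. digit b (a + b ^ k * x) (k + i) * b ^ (l - Suc i))"
    unfolding rev_digits_def sum_lessThan_add by simp
  also have "(\<Sum>i<k. digit b (a + b ^ k * x) i * b ^ (k + l - Suc i)) = b ^ l * rev_digits b k a"
    unfolding rev_digits_def sum_distrib_left
  proof (intro sum.cong refl)
    fix i assume "i \<in> {..<k}"
    then have "i < k" by simp
    then have "b ^ (k + l - Suc i) = b ^ l * b ^ (k - Suc i)"
      by (simp add: add.commute flip: power_add)
    with \<open>i < k\<close> assms show "digit b (a + b ^ k * x) i * b ^ (k + l - Suc i) =
        b ^ l * (digit b a i * b ^ (k - Suc i))"
      by (simp add: digit_append_low)
  qed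
  also have "(\<Sum>i<l. digit b (a + b ^ k * x) (k + i) * b ^ (l - Suc i)) = rev_digits b l x"
    using assms by (simp add: rev_digits_def digit_append_high)
  finally show ?thesis .
qed

text \<open>The recursion behind every argument below: removing \<open>k\<close> digits at both ends of such a palindrome
  leaves one of the same kind.\<close>

lemma pal_append:
  assumes "a < b ^ k"
  shows "pal b (k + l) (a + b ^ k * x) =
    a + b ^ (k + 2 * l + 1) * rev_digits b k a + b ^ k * pal b l x"
  unfolding pal_def rev_digits_append[OF assms]
  by (simp add: algebra_simps power_add mult_2_right)

lemma pal_less:
  assumes "a < b ^ h"
  shows "pal b h a < b ^ (2 * h + 1)"
proof -
  have "pal b h a < b ^ h + b ^ h + b ^ Suc h * (b ^ h - 1)"
    unfolding pal_def using assms rev_digits_less[of h a]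
    by (intro add_less_le_mono add_strict_right_mono mult_le_mono2) auto
  also have "\<dots> \<le> b ^ Suc h + b ^ Suc h * (b ^ h - 1)"
    using b2 by (simp flip: mult_2)
  also have "\<dots> = b ^ Suc h * b ^ h"
    using b2 by (simp add: algebra_simps) 
  finally show ?thesis by (simp add: power_add mult_2)
qed

lemma pal_ge:
  assumes "h > 0" "a mod b = 1"
  shows "pal b h a \<ge> b ^ (2 * h)"
proof -
  have "b ^ (h - Suc 0) \<le> rev_digits b h a"
    unfolding rev_digits_def using assms by (intro order.trans[OF _ member_le_sum[of 0]]) (auto simp: digit_def)
  then have "b ^ Suc h * b ^ (h - 1) \<le> pal b h a"
    unfolding pal_def by (simp add: trans_le_add2)
  then show ?thesis using assms(1)
    by (metis Suc_pred' add_Suc_shift mult_2 power_add One_nat_def)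
qed

lemma pal_mod:
  assumes "a < b ^ h" shows "pal b h a mod b ^ h = a"
proof -
  have "pal b h a = a + b ^ h * (1 + b * rev_digits b h a)"
    by (simp add: pal_def algebra_simps)
  with assms show ?thesis by (simp only: mod_mult_self2) simp
qed

lemma pal_inj:
  assumes "a < b ^ h" "a' < b ^ h" "pal b h a = pal b h a'"
  shows "a = a'"
  using assms pal_mod by metis

lemma palindrome_pal:
  assumes h: "h > 0" and a: "a < b ^ h" "a mod b = 1"
  shows "palindrome b (pal b h a)"
proof -
  define d where "d i = (if i < h then digit b a i else if i = h then 1 else digit b a (2 * h - i))" for i
  define N where "N = 2 * h + 1"
  have d_less: "d i < b" for i
    using b2 by (simp add: d_def digit_less)
  have N: "N = h + (1 + h)" by (simp add: N_def)
  have "(\<Sum>i<N. d i * b ^ i) =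
      (\<Sum>i<h. d i * b ^ i) + b ^ h + (\<Sum>i<h. d (Suc h + i) * b ^ (Suc h + i))"
    unfolding N sum_lessThan_add by (simp add: d_def)
  also have "(\<Sum>i<h. d i * b ^ i) = a"
    using a(1) sum_digits_mod[of b a h] by (simp add: d_def)
  also have "(\<Sum>i<h. d (Suc h + i) * b ^ (Suc h + i)) = b ^ Suc h * rev_digits b h a"
    unfolding rev_digits_as_expansion sum_distrib_left
    by (intro sum.cong) (auto simp: d_def power_add mult_2 mult_ac Suc_diff_Suc)
  finally have n: "pal b h a = (\<Sum>i<N. d i * b ^ i)"
    by (simp add: pal_def)
  have d0: "d 0 = 1" using h a by (simp add: d_def digit_def)
  have sym: "d (2 * h - i) = d i" if "i < N" for i
    using that by (auto simp: d_def N_def)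
  have num: "num_digits b (pal b h a) = N"
    unfolding n using b2 d_less sym[of 0] d0
    by (intro num_digits_expansion) (auto simp: N_def)
  have "digit_reverse b (pal b h a) = (\<Sum>i<N. d i * b ^ (N - 1 - i))"
    unfolding digit_reverse_def num unfolding n
    by (intro sum.cong refl) (simp add: digit_expansion d_less)
  also have "\<dots> = (\<Sum>i<N. d (N - Suc i) * b ^ (N - 1 - (N - Suc i)))"
    by (rule sum.nat_diff_reindex [symmetric])
  also have "\<dots> = (\<Sum>i<N. d i * b ^ i)"
    by (intro sum.cong refl) (use sym in \<open>auto simp: N_def\<close>)
  finally have rev: "pal b h a = digit_reverse b (pal b h a)"
    using n by simp
  have "pal b h a mod b = a mod b"
    using h by (cases h) (auto simp: pal_def mod_simps mult.assoc simp flip: mult_Suc_right)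
  with a b2 have "\<not> b dvd pal b h a" by (simp add: dvd_eq_mod_eq_0)
  with rev show ?thesis by (simp add: palindrome_def)
qed

lemma pal_mod_base:
  assumes "h > 0" "a mod b = 1"
  shows "pal b h a mod b = 1"
proof -
  have "pal b h a = a + b * (b ^ (h - 1) + b ^ h * rev_digits b h a)"
    using assms(1) by (cases h) (simp_all add: pal_def algebra_simps)
  with assms(2) show ?thesis by (simp only: mod_mult_self2)
qed

lemma odd_pal:
  assumes h: "h > 0" and a: "a < b ^ h" "a mod b = 1"
  shows "odd (pal b h a)"
proof (cases "even b")
  case True
  then obtain c where "b = 2 * c" by blast
  then have "pal b h a mod 2 = pal b h a mod b mod 2" by (simp add: mod_mod_cancel)
  also have "\<dots> = 1" using pal_mod_base[OF h a(2)] by simp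
  finally show ?thesis by (simp add: odd_iff_mod_2_eq_one)
next
  case False
  have "a + rev_digits b h a = (\<Sum>i<h. digit b a i * b ^ i + digit b a i * b ^ (h - Suc i))"
    using sum_digits_mod[of b a h] a(1) by (simp add: rev_digits_def sum.distrib)
  moreover have "even \<dots>"
    using False by (intro dvd_sum) simp
  ultimately have "even (a + rev_digits b h a)" by simp
  with False show ?thesis by (simp add: pal_def)
qed

lemma coprime_of_dvd_pal:
  assumes "h > 0" "a mod b = 1" "d dvd pal b h a"
  shows "coprime d b"
proof (rule coprimeI)
  fix c assume c: "c dvd d" "c dvd b"
  then have "c dvd pal b h a mod b" using assms(3) by (meson dvd_mod dvd_trans)
  then show "is_unit c" using pal_mod_base[OF assms(1,2)] by simp
qed

end

section \<open>Counting lemmas\<close>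

lemma sum_swap_card:
  assumes "finite A" "finite B"
  shows "(\<Sum>x\<in>A. card {y \<in> B. R x y}) = (\<Sum>y\<in>B. card {x \<in> A. R x y})"
proof -
  have "(\<Sum>x\<in>A. card {y \<in> B. R x y}) = (\<Sum>x\<in>A. \<Sum>y\<in>B. of_bool (R x y))"
    using assms by (simp add: Int_def)
  also have "\<dots> = (\<Sum>y\<in>B. \<Sum>x\<in>A. of_bool (R x y))"
    by (rule sum.swap)
  also have "\<dots> = (\<Sum>y\<in>B. card {x \<in> A. R x y})"
    using assms by (simp add: Int_def)
  finally show ?thesis .
qed

text \<open>In each class of \<open>t\<close> take the element with the smallest weight \<open>w\<close>; every other element is charged to
  the pair that it forms with this representative. Ordering the pair by \<open>w\<close> spares a discussion of signs later.\<close>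

lemma card_le_classes_plus_pairs:
  fixes w :: "'a \<Rightarrow> nat"
  assumes fin: "finite S" and inj: "inj_on w S" and t: "t ` S \<subseteq> {..<T::nat}"
  shows "card S \<le> T + card {(x, y) \<in> S \<times> S. t x = t y \<and> w y < w x}"
proof -
  let ?Q = "{(x, y) \<in> S \<times> S. t x = t y \<and> w y < w x}"
  define rep where "rep c = arg_min_on w {x \<in> S. t x = c}" for c
  have rep: "rep (t x) \<in> S" "t (rep (t x)) = t x" "w (rep (t x)) \<le> w x" if "x \<in> S" for x
  proof -
    have "finite {y \<in> S. t y = t x}" "{y \<in> S. t y = t x} \<noteq> {}" using fin that by auto
    from arg_min_if_finite(1)[OF this, of w] arg_min_least[OF this, of x w] that
    show "rep (t x) \<in> S" "t (rep (t x)) = t x" "w (rep (t x)) \<le> w x"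
      by (auto simp: rep_def)
  qed
  have "S \<subseteq> rep ` {..<T} \<union> fst ` ?Q"
  proof
    fix x assume x: "x \<in> S"
    show "x \<in> rep ` {..<T} \<union> fst ` ?Q"
    proof (cases "x = rep (t x)")
      case True
      then show ?thesis using t x by blast
    next
      case False
      then have "w (rep (t x)) < w x"
        using rep[OF x] x inj by (metis inj_on_def order_le_less)
      then have "(x, rep (t x)) \<in> ?Q" using rep[OF x] x by auto
      then show ?thesis by force
    qed
  qed
  moreover have finQ: "finite ?Q" using fin by (intro finite_subset[of ?Q "S \<times> S"]) auto
  ultimately have "card S \<le> card (rep ` {..<T} \<union> fst ` ?Q)"
    by (intro card_mono) auto
  also have "\<dots> \<le> card (rep ` {..<T}) + card (fst ` ?Q)" by (rule card_Un_le)
  also have "\<dots> \<le> T + card ?Q"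
    using card_image_le[of "{..<T}" rep] card_image_le[OF finQ, of fst] by simp
  finally show ?thesis .
qed

text \<open>A set inside one residue class modulo \<open>M\<close> and inside an interval of length \<open>\<Delta> / E\<close> has at most
  \<open>1 + \<Delta> / (M E)\<close> elements. The factor \<open>E\<close> keeps the bound free of divisions.\<close>

lemma card_le_if_mult_diffs_bounded:
  fixes S :: "nat set" and M E \<Delta> :: nat
  assumes fin: "finite S" and M: "M > 0"
    and cong: "\<And>x y. x \<in> S \<Longrightarrow> y \<in> S \<Longrightarrow> x mod M = y mod M"
    and diff: "\<And>x y. x \<in> S \<Longrightarrow> y \<in> S \<Longrightarrow> x < y \<Longrightarrow> (y - x) * E \<le> \<Delta>"
  shows "card S * (M * E) \<le> M * E + \<Delta>"
proof (cases "S = {}")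
  case False
  define x y where "x = Min S" and "y = Max S"
  have xy: "x \<in> S" "y \<in> S" and between: "x \<le> z" "z \<le> y" if "z \<in> S" for z
    using fin False that by (auto simp: x_def y_def)
  have "S \<subseteq> (\<lambda>j. x + M * j) ` {..(y - x) div M}"
  proof
    fix z assume z: "z \<in> S"
    then have "M dvd z - x"
      using cong[OF z xy(1)[OF z]] between(1)[OF z] by (simp add: mod_eq_dvd_iff_nat)
    then obtain j where j: "z - x = M * j" by blast
    have "M * j \<le> y - x" using between(2)[OF z] j by simp
    then have "j \<le> (y - x) div M" using M by (simp add: less_eq_div_iff_mult_less_eq mult.commute)
    moreover have "z = x + M * j" using j between(1)[OF z] by simp
    ultimately show "z \<in> (\<lambda>j. x + M * j) ` {..(y - x) div M}" by blast
  qed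
  then have "card S \<le> card ((\<lambda>j. x + M * j) ` {..(y - x) div M})"
    by (intro card_mono) auto
  also have "\<dots> \<le> (y - x) div M + 1"
    using card_image_le[of "{..(y - x) div M}"] by (simp add: le_trans)
  finally have "card S * (M * E) \<le> ((y - x) div M + 1) * (M * E)"
    by (intro mult_right_mono) auto
  also have "\<dots> = M * E + ((y - x) div M * M) * E" by (simp add: algebra_simps)
  also have "\<dots> \<le> M * E + (y - x) * E"
    by (intro add_left_mono mult_right_mono) auto
  also have "(y - x) * E \<le> \<Delta>"
  proof (cases "x < y")
    case True
    obtain z where "z \<in> S" using False by blast
    with True show ?thesis using diff xy by blast
  qed auto
  finally show ?thesis by simp
qed auto

section \<open>A fixed square: equidistribution of palindromes\<close>

context
  fixes b :: nat
  assumes b2: "b \<ge> 2"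
begin

lemma card_append_le:
  "card {z. z < b ^ (k + l) \<and> P z} \<le> (\<Sum>y<b ^ k. card {x. x < b ^ l \<and> P (y + b ^ k * x)})"
proof -
  have "{z. z < b ^ (k + l) \<and> P z} \<subseteq>
      (\<lambda>(y, x). y + b ^ k * x) ` (SIGMA y:{..<b ^ k}. {x. x < b ^ l \<and> P (y + b ^ k * x)})"
  proof clarify
    fix z assume z: "z < b ^ (k + l)" "P z"
    have "z div b ^ k < b ^ l"
      using z(1) by (simp add: power_add less_mult_imp_div_less mult.commute)
    then have "(z mod b ^ k, z div b ^ k) \<in> (SIGMA y:{..<b ^ k}. {x. x < b ^ l \<and> P (y + b ^ k * x)})"
      using z b2 by simp
    then show "z \<in> (\<lambda>(y, x). y + b ^ k * x) ` (SIGMA y:{..<b ^ k}. {x. x < b ^ l \<and> P (y + b ^ k * x)})"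
      by (rule rev_image_eqI) simp
  qed
  then have "card {z. z < b ^ (k + l) \<and> P z} \<le> card (SIGMA y:{..<b ^ k}. {x. x < b ^ l \<and> P (y + b ^ k * x)})"
    by (intro surj_card_le) auto
  also have "\<dots> = (\<Sum>y<b ^ k. card {x. x < b ^ l \<and> P (y + b ^ k * x)})"
    by (intro card_SigmaI) auto
  finally show ?thesis .
qed

text \<open>As \<open>b\<close> is invertible modulo \<open>q\<close>, prescribing the residue of the whole palindrome and its outer block \<open>y\<close>
  amounts to prescribing the residue \<open>T y\<close> of the inner palindrome. The second part says which blocks
  lead to a given \<open>T y\<close>.\<close>

lemma pal_append_cong_iff:
  assumes "coprime b q"
  shows "\<exists>T. (\<forall>y x. y < b ^ k \<longrightarrow>
        ([int (pal b (k + l) (y + b ^ k * x)) = c] (mod int q) \<longleftrightarrow> [int (pal b l x) = T y] (mod int q))) \<and>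
      (\<forall>y c'. [int (y + b ^ (k + 2 * l + 1) * rev_digits b k y) = c - int (b ^ k) * c'] (mod int q) \<longrightarrow>
        [T y = c'] (mod int q))"
proof -
  obtain w where w: "[int b * w = 1] (mod int q)"
    using assms cong_solve_coprime_int[of "int b" "int q"] by auto
  have wk: "[w ^ k * int b ^ k = 1] (mod int q)"
    using cong_pow[OF w, of k] by (simp add: power_mult_distrib mult.commute)
  define R where "R y = int (y + b ^ (k + 2 * l + 1) * rev_digits b k y)" for y
  have iff: "[m = w ^ k * z] (mod int q) \<longleftrightarrow> [int b ^ k * m = z] (mod int q)" for m z
  proof
    assume "[m = w ^ k * z] (mod int q)"
    then have "[int b ^ k * m = int b ^ k * (w ^ k * z)] (mod int q)" by (rule cong_scalar_left)
    also have "[int b ^ k * (w ^ k * z) = 1 * z] (mod int q)"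
      using cong_scalar_right[OF wk, of z] by (simp add: mult_ac)
    finally show "[int b ^ k * m = z] (mod int q)" by simp
  next
    assume "[int b ^ k * m = z] (mod int q)"
    then have "[w ^ k * (int b ^ k * m) = w ^ k * z] (mod int q)" by (rule cong_scalar_left)
    moreover have "[w ^ k * (int b ^ k * m) = 1 * m] (mod int q)"
      using cong_scalar_right[OF wk, of m] by (simp add: mult_ac)
    ultimately show "[m = w ^ k * z] (mod int q)" by (metis cong_sym cong_trans mult_1)
  qed
  show ?thesis
  proof (intro exI[of _ "\<lambda>y. w ^ k * (c - R y)"] conjI allI impI)
    fix y x assume y: "y < b ^ k"
    have "int (pal b (k + l) (y + b ^ k * x)) = int b ^ k * int (pal b l x) + R y"
      unfolding pal_append[OF b2 y] R_def by simp
    then show "[int (pal b (k + l) (y + b ^ k * x)) = c] (mod int q) \<longleftrightarrow>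
        [int (pal b l x) = w ^ k * (c - R y)] (mod int q)"
      unfolding iff by (simp add: cong_iff_dvd_diff algebra_simps)
  next
    fix y c' assume "[int (y + b ^ (k + 2 * l + 1) * rev_digits b k y) = c - int (b ^ k) * c'] (mod int q)"
    then have "[c - R y = c - (c - int (b ^ k) * c')] (mod int q)"
      unfolding R_def by (intro cong_diff cong_refl)
    then have "[int b ^ k * c' = c - R y] (mod int q)" by (simp add: cong_sym)
    then have "[c' = w ^ k * (c - R y)] (mod int q)" unfolding iff .
    then show "[w ^ k * (c - R y) = c'] (mod int q)" by (rule cong_sym)
  qed
qed

text \<open>If \<open>b\<^sup>u\<close> is \<open>1\<close> modulo \<open>q\<close>, a digit \<open>1\<close> at a position divisible by \<open>u\<close>, together with its
  mirror image, contributes \<open>1 + 1\<close>. So \<open>t\<close> blocks of length \<open>u\<close> reach the residues \<open>0, 2, \<dots>, 2t\<close>,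
  which for odd \<open>q\<close> and \<open>t = q\<close> are all residues.\<close>

lemma block_residues:
  assumes u: "u > 0" "[b ^ u = 1] (mod q)" "u dvd l" and t: "t' \<le> t"
  shows "\<exists>y<b ^ (u * t). [y + b ^ (u * t + 2 * l + 1) * rev_digits b (u * t) y = 2 * t'] (mod q)"
  using t
proof (induction t arbitrary: t')
  case (Suc t)
  define d where "d = (if t' = 0 then 0 else 1 :: nat)"
  have "t' - d \<le> t" using Suc.prems by (cases t') (auto simp: d_def)
  from Suc.IH[OF this] obtain y where y: "y < b ^ (u * t)"
    and cong: "[y + b ^ (u * t + 2 * l + 1) * rev_digits b (u * t) y = 2 * (t' - d)] (mod q)" by blast
  have d: "d < b ^ u" using b2 u(1) one_less_power[of b u] by (auto simp: d_def)
  have one: "[b ^ n = 1] (mod q)" if n: "u dvd n" for n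
  proof -
    obtain j where "n = u * j" using n by blast
    then show ?thesis using cong_pow[OF u(2), of j] by (simp add: power_mult)
  qed
  obtain v where v: "u = Suc v" using u(1) by (cases u) auto
  have rev_digits_d: "rev_digits b u d = d * b ^ v"
  proof -
    have "rev_digits b (1 + v) (d + b ^ 1 * 0) = b ^ v * rev_digits b 1 d + rev_digits b v 0"
      using b2 by (intro rev_digits_append[OF b2]) (simp add: d_def)
    also have "rev_digits b v 0 = 0" by (simp add: rev_digits_def digit_def)
    also have "rev_digits b 1 d = d" using b2 by (simp add: rev_digits_def digit_def d_def)
    finally show ?thesis by (simp add: v)
  qed
  let ?y = "d + b ^ u * y"
  have "d + b ^ u * y < b ^ u * (y + 1)" using d by simp
  also have "\<dots> \<le> b ^ u * b ^ (u * t)" using y by (intro mult_left_mono) auto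
  finally have less: "?y < b ^ (u * Suc t)" by (simp add: power_add)
  have exps: "b ^ (u * Suc t + 2 * l + 1) * (b ^ (u * t) * b ^ v) = b ^ (2 * (u * Suc t + l))"
    "b ^ (u * Suc t + 2 * l + 1) = b ^ u * b ^ (u * t + 2 * l + 1)"
    unfolding power_add [symmetric] by (rule arg_cong[where f = "(^) b"], simp add: v)+
  have "?y + b ^ (u * Suc t + 2 * l + 1) * rev_digits b (u * Suc t) ?y =
      ?y + b ^ (u * Suc t + 2 * l + 1) * (b ^ (u * t) * (d * b ^ v) + rev_digits b (u * t) y)"
    using rev_digits_append[OF b2 d, of "u * t" y] rev_digits_d by simp
  also have "\<dots> = d * (1 + b ^ (u * Suc t + 2 * l + 1) * (b ^ (u * t) * b ^ v)) +
      (b ^ u * y + b ^ (u * Suc t + 2 * l + 1) * rev_digits b (u * t) y)"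
    by (simp only: distrib_left mult_1_right mult_ac add_ac)
  also have "\<dots> = d * (1 + b ^ (2 * (u * Suc t + l))) +
      b ^ u * (y + b ^ (u * t + 2 * l + 1) * rev_digits b (u * t) y)"
    unfolding exps(1) unfolding exps(2) by (simp only: distrib_left mult.assoc)
  also have "[\<dots> = d * (1 + 1) + 1 * (2 * (t' - d))] (mod q)"
    using u(3) by (intro cong_add cong_mult cong_refl one cong) auto
  also have "d * (1 + 1) + 1 * (2 * (t' - d)) = 2 * t'" by (cases t') (auto simp: d_def)
  finally show ?case using less by blast
qed (auto simp: rev_digits_def)

text \<open>Let \<open>\<mu>\<close> bound the proportion of every residue class among inner palindromes. Some class has a proportion
  of at most \<open>1 / q\<close>, and by \<open>block_residues\<close> at least one of the \<open>b\<^sup>k\<close> outer blocks leads to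
  that class. With \<open>\<beta> = b\<^sup>-\<^sup>k\<close> the bound for the longer palindromes is therefore
  \<open>(1 - \<beta>) \<mu> + \<beta> / q\<close>, so that \<open>\<mu> - 1 / q\<close> decays geometrically.\<close>

lemma pal_equidistributed:
  fixes q :: nat and \<epsilon> :: real
  assumes q: "odd q" "coprime b q" and \<epsilon>: "\<epsilon> > 0"
  shows "\<exists>l0. \<forall>l\<ge>l0. \<forall>c. real (card {x. x < b ^ l \<and> [int (pal b l x) = c] (mod int q)}) \<le> (1 / real q + \<epsilon>) * real b ^ l"
proof -
  define cnt where "cnt l c = card {x. x < b ^ l \<and> [int (pal b l x) = c] (mod int q)}" for l c
  define bd where "bd l \<mu> \<longleftrightarrow> (\<forall>c. real (cnt l c) \<le> \<mu> * real b ^ l)" for l and \<mu> :: real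
  have q0: "q > 0" using q(1) by (cases q) auto
  have b0: "real b > 0" using b2 by simp
  have cnt_cong: "cnt l c = cnt l c'" if "[c = c'] (mod int q)" for l c c'
    unfolding cnt_def using that by (metis cong_sym cong_trans)
  have step: "\<exists>T. cnt (k + l) c \<le> (\<Sum>y<b ^ k. cnt l (T y)) \<and>
      (\<forall>y c'. [int (y + b ^ (k + 2 * l + 1) * rev_digits b k y) = c - int (b ^ k) * c'] (mod int q) \<longrightarrow>
        [T y = c'] (mod int q))" for k l c
  proof -
    obtain T where T: "\<And>y x. y < b ^ k \<Longrightarrow> [int (pal b (k + l) (y + b ^ k * x)) = c] (mod int q) \<longleftrightarrow>
        [int (pal b l x) = T y] (mod int q)"
      "\<And>y c'. [int (y + b ^ (k + 2 * l + 1) * rev_digits b k y) = c - int (b ^ k) * c'] (mod int q) \<Longrightarrow>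
        [T y = c'] (mod int q)"
      using pal_append_cong_iff[OF q(2), of k l c] by blast
    have "cnt (k + l) c \<le> (\<Sum>y<b ^ k. card {x. x < b ^ l \<and> [int (pal b (k + l) (y + b ^ k * x)) = c] (mod int q)})"
      unfolding cnt_def by (rule card_append_le)
    also have "\<dots> = (\<Sum>y<b ^ k. cnt l (T y))"
      unfolding cnt_def using T(1) by (intro sum.cong refl) simp
    finally show ?thesis using T(2) by blast
  qed
  have mono: "bd (k + l) \<mu>" if bd: "bd l \<mu>" for k l \<mu>
    unfolding bd_def
  proof
    fix c
    obtain T where "cnt (k + l) c \<le> (\<Sum>y<b ^ k. cnt l (T y))" using step by blast
    then have "real (cnt (k + l) c) \<le> (\<Sum>y<b ^ k. real (cnt l (T y)))"
      by (simp flip: of_nat_sum)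
    also have "\<dots> \<le> (\<Sum>y<b ^ k. \<mu> * real b ^ l)"
      using bd unfolding bd_def by (intro sum_mono) blast
    also have "\<dots> = \<mu> * real b ^ (k + l)" by (simp add: power_add)
    finally show "real (cnt (k + l) c) \<le> \<mu> * real b ^ (k + l)" .
  qed
  define u where "u = totient q"
  have u: "u > 0" "[b ^ u = 1] (mod q)"
    using q0 euler_theorem[OF q(2)] by (auto simp: u_def)
  define k where "k = u * q"
  define \<beta> where "\<beta> = 1 / real b ^ k"
  have \<beta>: "0 < \<beta>" using b0 by (simp add: \<beta>_def)
  have contract: "bd (k + l) (\<mu> - (\<mu> - 1 / real q) * \<beta>)" if bd: "bd l \<mu>" and l: "u dvd l" for l \<mu>
    unfolding bd_def
  proof
    fix c
    obtain T where T: "cnt (k + l) c \<le> (\<Sum>y<b ^ k. cnt l (T y))"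
      and T': "\<And>y c'. [int (y + b ^ (k + 2 * l + 1) * rev_digits b k y) = c - int (b ^ k) * c'] (mod int q) \<Longrightarrow>
        [T y = c'] (mod int q)"
      using step[of k l c] by blast
    have "\<exists>c0<q. real (cnt l (int c0)) \<le> real b ^ l / real q"
    proof (rule ccontr)
      assume "\<not> ?thesis"
      then have "(\<Sum>c0<q. real b ^ l / real q) < (\<Sum>c0<q. real (cnt l (int c0)))"
        using q0 by (intro sum_strict_mono) (auto simp: not_le)
      then have "real b ^ l < real (\<Sum>c0<q. cnt l (int c0))"
        using q0 by simp
      also have "(\<Sum>c0<q. cnt l (int c0)) = (\<Sum>x<b ^ l. card {c0 \<in> {..<q}. [int (pal b l x) = int c0] (mod int q)})"
        using sum_swap_card[of "{..<q}" "{..<b ^ l}" "\<lambda>c0 x. [int (pal b l x) = int c0] (mod int q)"]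
        by (simp add: cnt_def)
      also have "\<dots> \<le> (\<Sum>x<b ^ l. card {pal b l x mod q})"
        unfolding cong_int_iff by (intro sum_mono card_mono) (auto simp: cong_def)
      finally show False by simp
    qed
    then obtain c0 where c0: "real (cnt l (int c0)) \<le> real b ^ l / real q" by blast
    have "coprime 2 (int q)" using q(1) by simp
    then obtain h where h: "[2 * h = 1] (mod int q)"
      using cong_solve_coprime_int by blast
    define z where "z = c - int (b ^ k) * int c0"
    define t' where "t' = nat ((h * z) mod int q)"
    have t'_int: "int t' = (h * z) mod int q" using q0 by (simp add: t'_def)
    have "t' \<le> q" using q0 by (simp add: t'_def nat_le_iff pos_mod_bound less_imp_le)
    from block_residues[OF u l this] obtain y where y: "y < b ^ k"
      and y': "[y + b ^ (k + 2 * l + 1) * rev_digits b k y = 2 * t'] (mod q)" by (auto simp: k_def)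
    have "[int (y + b ^ (k + 2 * l + 1) * rev_digits b k y) = int (2 * t')] (mod int q)"
      using y' by (simp only: cong_int_iff)
    also have "int (2 * t') = 2 * int t'" by simp
    also have "[2 * int t' = 2 * (h * z)] (mod int q)"
      unfolding t'_int by (intro cong_scalar_left) simp
    also have "[2 * (h * z) = 1 * z] (mod int q)"
      using cong_scalar_right[OF h, of z] by (simp add: mult_ac)
    finally have "[T y = int c0] (mod int q)" by (intro T') (simp add: z_def)
    then have Ty: "real (cnt l (T y)) \<le> real b ^ l / real q" using c0 cnt_cong by metis
    have "real (cnt (k + l) c) \<le> (\<Sum>y<b ^ k. real (cnt l (T y)))"
      using T by (simp flip: of_nat_sum)
    also have "\<dots> = real (cnt l (T y)) + (\<Sum>y\<in>{..<b ^ k} - {y}. real (cnt l (T y)))"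
      using y by (intro sum.remove) auto
    also have "\<dots> \<le> real b ^ l / real q + (\<Sum>y\<in>{..<b ^ k} - {y}. \<mu> * real b ^ l)"
      using bd unfolding bd_def by (intro add_mono Ty sum_mono) blast
    also have "\<dots> = real b ^ l / real q + (real b ^ k - 1) * (\<mu> * real b ^ l)"
      using y by (simp add: of_nat_diff)
    also have "\<dots> = (\<mu> - (\<mu> - 1 / real q) * \<beta>) * real b ^ (k + l)"
      using b0 q0 by (simp add: \<beta>_def power_add field_simps)
    finally show "real (cnt (k + l) c) \<le> (\<mu> - (\<mu> - 1 / real q) * \<beta>) * real b ^ (k + l)" .
  qed
  have iter: "bd (k * J) (1 / real q + (1 - \<beta>) ^ J)" for J
  proof (induction J)
    case 0
    have "cnt 0 c \<le> card {..<1::nat}" for c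
      unfolding cnt_def by (intro card_mono) auto
    then have "real (cnt 0 c) \<le> 1" for c by simp
    moreover have "0 \<le> 1 / real q" by simp
    ultimately show ?case unfolding bd_def by (simp add: add_increasing)
  next
    case (Suc J)
    have "bd (k + k * J) (1 / real q + (1 - \<beta>) ^ J - (1 / real q + (1 - \<beta>) ^ J - 1 / real q) * \<beta>)"
      by (rule contract[OF Suc]) (simp add: k_def)
    then show ?case by (simp add: algebra_simps)
  qed
  obtain J where J: "(1 - \<beta>) ^ J < \<epsilon>" using real_arch_pow_inv[OF \<epsilon>, of "1 - \<beta>"] \<beta> by auto
  show ?thesis
  proof (intro exI allI impI)
    fix l c assume l: "k * J \<le> l"
    have "bd (l - k * J + k * J) (1 / real q + (1 - \<beta>) ^ J)" by (rule mono[OF iter])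
    then have "real (cnt l c) \<le> (1 / real q + (1 - \<beta>) ^ J) * real b ^ l" using l unfolding bd_def by simp
    also have "\<dots> \<le> (1 / real q + \<epsilon>) * real b ^ l" using J b0 by (intro mult_right_mono) auto
    finally show "real (card {x. x < b ^ l \<and> [int (pal b l x) = c] (mod int q)}) \<le> (1 / real q + \<epsilon>) * real b ^ l"
      by (simp add: cnt_def)
  qed
qed

lemma card_square_divisors_small:
  fixes d :: nat and \<epsilon> :: real
  assumes d: "odd d" "coprime b d" and \<epsilon>: "\<epsilon> > 0"
  shows "\<forall>\<^sub>F h in sequentially. real (card {a. a < b ^ h \<and> a mod b = 1 \<and> d\<^sup>2 dvd pal b h a})
    \<le> (1 / (real d)\<^sup>2 + \<epsilon>) * real b ^ (h - 1)"
proof -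
  have "odd (d\<^sup>2)" "coprime b (d\<^sup>2)" using d by auto
  from pal_equidistributed[OF this \<epsilon>] obtain l0 where l0: "\<And>l c. l0 \<le> l \<Longrightarrow>
      real (card {x. x < b ^ l \<and> [int (pal b l x) = c] (mod int (d\<^sup>2))}) \<le> (1 / real (d\<^sup>2) + \<epsilon>) * real b ^ l"
    by blast
  show ?thesis
    unfolding eventually_sequentially
  proof (intro exI allI impI)
    fix h assume h: "Suc l0 \<le> h"
    define l where "l = h - 1"
    have h_eq: "h = 1 + l" and l: "l0 \<le> l" using h by (auto simp: l_def)
    obtain T where T: "\<And>y x. y < b ^ 1 \<Longrightarrow> [int (pal b (1 + l) (y + b ^ 1 * x)) = 0] (mod int (d\<^sup>2)) \<longleftrightarrow>
        [int (pal b l x) = T y] (mod int (d\<^sup>2))"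
      using pal_append_cong_iff[OF \<open>coprime b (d\<^sup>2)\<close>, of 1 l 0] by blast
    have "{a. a < b ^ h \<and> a mod b = 1 \<and> d\<^sup>2 dvd pal b h a} \<subseteq>
        (\<lambda>x. 1 + b * x) ` {x. x < b ^ l \<and> [int (pal b l x) = T 1] (mod int (d\<^sup>2))}"
    proof clarify
      fix a assume a: "a < b ^ h" "a mod b = 1" "d\<^sup>2 dvd pal b h a"
      have eq: "a = 1 + b * (a div b)" using a(2) by (metis add.commute mult_div_mod_eq)
      have "a div b < b ^ l" using a(1) by (simp add: h_eq less_mult_imp_div_less mult.commute)
      moreover have "[int (pal b l (a div b)) = T 1] (mod int (d\<^sup>2))"
        using T[of 1 "a div b"] eq a(3) b2 by (simp add: cong_0_iff h_eq del: of_nat_power)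
      ultimately show "a \<in> (\<lambda>x. 1 + b * x) ` {x. x < b ^ l \<and> [int (pal b l x) = T 1] (mod int (d\<^sup>2))}"
        using eq by blast
    qed
    then have "card {a. a < b ^ h \<and> a mod b = 1 \<and> d\<^sup>2 dvd pal b h a} \<le>
        card {x. x < b ^ l \<and> [int (pal b l x) = T 1] (mod int (d\<^sup>2))}"
      by (intro surj_card_le) auto
    also have "real \<dots> \<le> (1 / (real d)\<^sup>2 + \<epsilon>) * real b ^ (h - 1)"
      using l0[OF l, of "T 1"] by (simp add: l_def)
    finally show "real (card {a. a < b ^ h \<and> a mod b = 1 \<and> d\<^sup>2 dvd pal b h a})
      \<le> (1 / (real d)\<^sup>2 + \<epsilon>) * real b ^ (h - 1)" by simp
  qed
qed

end

section \<open>Squares of numbers of medium size\<close>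

context
  fixes b :: nat
  assumes b2: "b \<ge> 2"
begin

text \<open>Here \<open>s = 4g + 1 + r\<close>. The multiple \<open>p\<^sup>2 m\<close> lies within \<open>W = 2 b\<^sup>1\<^sup>1\<^sup>g\<^sup>+\<^sup>2\<^sup>r\<^sup>+\<^sup>1\<close> of
  \<open>A = b\<^sup>1\<^sup>5\<^sup>g\<^sup>+\<^sup>2\<^sup>r\<^sup>+\<^sup>1 E\<close> and is
  congruent to \<open>D\<close> modulo \<open>M = b\<^sup>7\<^sup>g\<close>. The residue of \<open>p\<close> modulo \<open>M\<close> thus fixes that of \<open>m\<close>,
  and as \<open>m < M E\<close>, there are at most \<open>E\<close> values of \<open>m\<close> for each of the \<open>M\<close> residues. Given both, \<open>p\<close> lies
  in a short interval, because \<open>p\<^sup>2 = A / m\<close> up to a relative error \<open>W / A\<close>, and in a fixed residue class modulo \<open>M\<close>.\<close>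

lemma card_near_square_divisors:
  fixes g r E :: nat and D :: int
  assumes g: "g \<ge> 1" and E: "E \<ge> 1" and D: "\<bar>D\<bar> < int (b ^ (3 * g))"
  defines "H \<equiv> {p. b ^ (4 * g + 1 + r) \<le> p \<and> p < b ^ (4 * g + 2 + r) \<and> coprime p b \<and>
      (\<exists>e. \<bar>e\<bar> < int (b ^ (4 * g + 2 * r + 1)) \<and>
         (int p)\<^sup>2 dvd D + int (b ^ (15 * g + 2 * r + 1) * E) + int (b ^ (7 * g)) * e)}"
  shows "card H \<le> b ^ (7 * g) * E + 4 * b ^ (r + 3)"
proof -
  define M where "M = b ^ (7 * g)"
  define A where "A = int (b ^ (15 * g + 2 * r + 1) * E)"
  define W where "W = 2 * int (b ^ (11 * g + 2 * r + 1))"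
  define s where "s = 4 * g + 1 + r"
  define B where "B = int b"
  have B2: "B \<ge> 2" and B1: "B \<ge> 1" using b2 by (auto simp: B_def)
  have M0: "M > 0" using b2 by (simp add: M_def)
  have finH: "finite H" unfolding H_def by (rule finite_subset[of _ "{..<b ^ (4 * g + 2 + r)}"]) auto
  have W_A: "8 * W \<le> A"
  proof -
    have "(2::int) ^ 4 \<le> B ^ 4" using B2 by (intro power_mono) auto
    also have "\<dots> \<le> B ^ (4 * g)" using B1 g by (intro power_increasing) auto
    finally have "16 * B ^ (11 * g + 2 * r + 1) \<le> B ^ (4 * g) * B ^ (11 * g + 2 * r + 1)"
      using B1 by (intro mult_right_mono) auto
    also have "\<dots> = B ^ (15 * g + 2 * r + 1)" by (simp flip: power_add)
    also have "\<dots> \<le> B ^ (15 * g + 2 * r + 1) * int E" using E B1 by simp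
    finally show ?thesis by (simp add: W_def A_def B_def)
  qed
  have W0: "W > 0" using b2 by (simp add: W_def)
  \<comment> \<open>the bounds on \<open>D\<close> and \<open>e\<close> enter through \<open>W\<close>\<close>
  have ex: "\<exists>m::nat. \<bar>int m * (int p)\<^sup>2 - A\<bar> < W \<and> [int m * (int p)\<^sup>2 = D] (mod int M)"
    if p: "p \<in> H" for p
  proof -
    from p obtain e k where e: "\<bar>e\<bar> < int (b ^ (4 * g + 2 * r + 1))"
      and k: "D + A + int M * e = (int p)\<^sup>2 * k"
      unfolding H_def A_def M_def by blast
    have "\<bar>D + int M * e\<bar> \<le> \<bar>D\<bar> + int M * \<bar>e\<bar>"
      by (metis abs_mult abs_of_nat abs_triangle_ineq)
    also have "\<dots> < B ^ (3 * g) + B ^ (7 * g) * B ^ (4 * g + 2 * r + 1)"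
      using D e M0 unfolding M_def B_def by (intro add_strict_mono mult_strict_left_mono) auto
    also have "\<dots> \<le> B ^ (11 * g + 2 * r + 1) + B ^ (11 * g + 2 * r + 1)"
      using B1 by (intro add_mono power_increasing) (auto simp flip: power_add)
    finally have near: "\<bar>(int p)\<^sup>2 * k - A\<bar> < W"
      using k by (simp add: W_def B_def algebra_simps)
    have "(int p)\<^sup>2 * k > 0" using near W_A W0 by linarith
    then have "k > 0" by (simp add: zero_less_mult_iff)
    then have "int (nat k) = k" by simp
    moreover have "[A + int M * e + D = D] (mod int M)"
    proof -
      have "A = int M * (int (b ^ (8 * g + 2 * r + 1) * E))"
        by (simp add: A_def M_def flip: power_add mult.assoc)
      then have "A + int M * e + D = D + int M * (int (b ^ (8 * g + 2 * r + 1) * E) + e)"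
        by (simp add: distrib_left)
      then show ?thesis unfolding cong_def by (simp only: mod_mult_self2)
    qed
    ultimately show ?thesis using near k
      by (intro exI[of _ "nat k"]) (simp add: mult.commute add_ac)
  qed
  define m where "m p = (SOME m. \<bar>int m * (int p)\<^sup>2 - A\<bar> < W \<and> [int m * (int p)\<^sup>2 = D] (mod int M))" for p
  have m: "\<bar>int (m p) * (int p)\<^sup>2 - A\<bar> < W" "[int (m p) * (int p)\<^sup>2 = D] (mod int M)"
    if "p \<in> H" for p
    using someI_ex[OF ex[OF that]] unfolding m_def by blast+
  have p_ge: "B ^ s \<le> int p" and p_less: "int p < B ^ Suc s" and p_cop: "coprime p M"
    if "p \<in> H" for p
    unfolding s_def B_def of_nat_power [symmetric] of_nat_le_iff of_nat_less_iff
    using that by (auto simp: H_def M_def)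
  have m_less: "m p < M * E" if p: "p \<in> H" for p
  proof -
    have "int (m p) * B ^ (2 * s) \<le> int (m p) * (int p)\<^sup>2"
      unfolding power_even_eq using p_ge[OF p] B1 by (intro mult_left_mono power_mono) auto
    also have "\<dots> < A + W" using m(1)[OF p] by linarith
    also have "\<dots> \<le> 2 * A" using W_A W0 by linarith
    also have "\<dots> \<le> B * A" using B2 W_A W0 by (intro mult_right_mono) linarith+
    also have "\<dots> = int (M * E) * B ^ (2 * s)"
    proof -
      have "B * B ^ (15 * g + 2 * r + 1) = B ^ (7 * g) * B ^ (2 * s)"
        unfolding power_Suc [symmetric] power_add [symmetric] s_def
        by (rule arg_cong[where f = "(^) B"]) simp
      then show ?thesis by (simp add: A_def M_def B_def mult_ac)
    qed
    finally have "int (m p) < int (M * E)" using B1 by (simp del: of_nat_mult)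
    then show ?thesis by (simp only: of_nat_less_iff)
  qed
  have m_greater: "int (M * E) \<le> 2 * B ^ 3 * int (m p)" if p: "p \<in> H" for p
  proof -
    have "A - W \<le> int (m p) * (int p)\<^sup>2" using m(1)[OF p] by linarith
    then have "A \<le> 2 * (int (m p) * (int p)\<^sup>2)" using W_A W0 by linarith
    also have "\<dots> \<le> 2 * (int (m p) * (B ^ Suc s)\<^sup>2)"
      using p_less[OF p] B1 by (intro mult_left_mono power_mono) auto
    finally have "A \<le> 2 * (int (m p) * (B ^ Suc s)\<^sup>2)" .
    moreover have "A = int (M * E) * B ^ (8 * g + 2 * r + 1)"
    proof -
      have "B ^ (15 * g + 2 * r + 1) = B ^ (7 * g) * B ^ (8 * g + 2 * r + 1)"
        unfolding power_add [symmetric] by (rule arg_cong[where f = "(^) B"]) simp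
      then show ?thesis by (simp add: A_def M_def B_def mult_ac)
    qed
    moreover have "(B ^ Suc s)\<^sup>2 = B ^ 3 * B ^ (8 * g + 2 * r + 1)"
      unfolding power_mult [symmetric] power_add [symmetric] s_def
      by (rule arg_cong[where f = "(^) B"]) simp
    ultimately have "int (M * E) * B ^ (8 * g + 2 * r + 1) \<le> (2 * B ^ 3 * int (m p)) * B ^ (8 * g + 2 * r + 1)"
      by (simp add: mult_ac)
    then show ?thesis using B1 by (simp del: of_nat_mult)
  qed
  define f where "f p = (p mod M, m p div M)" for p
  have fibre: "card {p \<in> H. f p = y} * (M * E) \<le> M * E + 4 * b ^ (r + 3)" for y
  proof (rule card_le_if_mult_diffs_bounded)
    fix p p' assume "p \<in> {p \<in> H. f p = y}" "p' \<in> {p \<in> H. f p = y}"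
    then have p: "p \<in> H" "p' \<in> H" and f: "p mod M = p' mod M" "m p div M = m p' div M"
      by (auto simp: f_def)
    then show "p mod M = p' mod M" by blast
    assume less: "p < p'"
    have "[int p = int p'] (mod int M)" using f(1) by (simp only: cong_int_iff cong_def [of p])
    then have "[int (m p) * (int p)\<^sup>2 = int (m p) * (int p')\<^sup>2] (mod int M)"
      by (intro cong_mult cong_pow) auto
    with m(2)[OF p(1)] m(2)[OF p(2)] have "[int (m p) * (int p')\<^sup>2 = int (m p') * (int p')\<^sup>2] (mod int M)"
      by (meson cong_sym cong_trans)
    moreover have "coprime ((int p')\<^sup>2) (int M)" using p_cop[OF p(2)] by simp
    ultimately have "[int (m p) = int (m p')] (mod int M)"
      using cong_mult_rcancel by blast
    then have "[m p = m p'] (mod M)" by (simp only: cong_int_iff)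
    then have "m p mod M = m p' mod M" by (simp only: cong_def)
    with f(2) have mm: "m p = m p'" by (metis div_mult_mod_eq)
    define d where "d = int (p' - p)"
    have d: "int p' = int p + d" "d > 0" using less by (auto simp: d_def)
    \<comment> \<open>two members of a fibre have the same \<open>m\<close>, so \<open>(p\<^sub>1\<^sup>2 - p\<^sup>2) m < 2W\<close>\<close>
    have "2 * B ^ s * d \<le> (2 * int p + d) * d"
      using d p_ge[OF p(1)] by (intro mult_right_mono) auto
    also have "\<dots> = (int p')\<^sup>2 - (int p)\<^sup>2" using d(1) by (simp add: power2_eq_square algebra_simps)
    finally have "(2 * B ^ s * d) * int (m p) \<le> ((int p')\<^sup>2 - (int p)\<^sup>2) * int (m p)"
      by (intro mult_right_mono) auto
    also have "\<dots> < 2 * W"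
      using m(1)[OF p(1)] m(1)[OF p(2)] mm by (simp add: algebra_simps)
    finally have 1: "(2 * B ^ s * d) * int (m p) < 2 * W" .
    have "2 * B ^ s * d * int (M * E) \<le> 2 * B ^ s * d * (2 * B ^ 3 * int (m p))"
      using m_greater[OF p(1)] d B1 by (intro mult_left_mono) auto
    also have "\<dots> = 2 * B ^ 3 * (2 * B ^ s * d * int (m p))" by (simp add: mult_ac)
    also have "\<dots> \<le> 2 * B ^ 3 * (2 * W)" using 1 B1 by (intro mult_left_mono) auto
    also have "\<dots> = 2 * B ^ (11 * g + r + 1) * (4 * B ^ (r + 3))"
    proof -
      have "B ^ 3 * B ^ (11 * g + 2 * r + 1) = B ^ (11 * g + r + 1) * B ^ (r + 3)"
        unfolding power_add [symmetric] by (rule arg_cong[where f = "(^) B"]) simp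
      then show ?thesis by (simp add: W_def B_def mult_ac)
    qed
    also have "2 * B ^ s * d * int (M * E) = 2 * B ^ (11 * g + r + 1) * (d * int E)"
    proof -
      have "B ^ s * B ^ (7 * g) = B ^ (11 * g + r + 1)"
        unfolding power_add [symmetric] s_def by (rule arg_cong[where f = "(^) B"]) simp
      then have "2 * (B ^ s * B ^ (7 * g)) * (d * int E) = 2 * B ^ (11 * g + r + 1) * (d * int E)"
        by (simp only:)
      then show ?thesis by (simp add: M_def B_def mult_ac)
    qed
    finally have "2 * B ^ (11 * g + r + 1) * (d * int E) \<le> 2 * B ^ (11 * g + r + 1) * (4 * B ^ (r + 3))" .
    moreover have "0 < 2 * B ^ (11 * g + r + 1)" using B1 by simp
    ultimately have "d * int E \<le> 4 * B ^ (r + 3)" by (simp only: mult_le_cancel_left_pos)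
    then have "int ((p' - p) * E) \<le> int (4 * b ^ (r + 3))" by (simp add: d_def B_def)
    then show "(p' - p) * E \<le> 4 * b ^ (r + 3)" by linarith
  qed (use finH M0 in auto)
  have "card H * (M * E) = (\<Sum>y\<in>f ` H. card {p \<in> H. f p = y}) * (M * E)"
    using sum.image_gen[OF finH, of "\<lambda>_. 1::nat" f] by simp
  also have "\<dots> \<le> (\<Sum>y\<in>f ` H. M * E + 4 * b ^ (r + 3))"
    unfolding sum_distrib_right by (intro sum_mono fibre)
  also have "\<dots> \<le> card ({..<M} \<times> {..<E}) * (M * E + 4 * b ^ (r + 3))"
  proof -
    have "f ` H \<subseteq> {..<M} \<times> {..<E}"
      using M0 m_less by (auto simp: f_def less_mult_imp_div_less mult.commute)
    then have "card (f ` H) \<le> card ({..<M} \<times> {..<E})" by (intro card_mono) auto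
    then show ?thesis by (simp only: sum_constant) (simp add: mult_right_mono)
  qed
  finally have "card H * (M * E) \<le> (M * E + 4 * b ^ (r + 3)) * (M * E)"
    by (simp add: mult.commute)
  then show ?thesis using M0 E b2 by (simp add: M_def)
qed

text \<open>Here \<open>\<rho>\<close> is the block of \<open>3g\<close> varying digits, followed by \<open>2g\<close> fixed digits, and \<open>x\<close> consists of the
  \<open>s - 1 = 4g + r\<close> digits next to the middle digit. In the application \<open>c\<close> collects
  the contribution of all fixed digits. A
  solution is determined by \<open>\<rho>\<close>, since the palindrome of \<open>x\<close> is smaller than \<open>p\<^sup>2\<close>. The \<open>2g\<close> fixed
  digits create a gap between \<open>\<rho>\<close> and \<open>x\<close>: it makes the main term of a difference so large that
  already for \<open>E = 1\<close> the multipliers \<open>m\<close> above are comparable with the modulus \<open>b\<^sup>7\<^sup>g\<close>.\<close>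

lemma sum_card_inner_solutions:
  fixes g r K :: nat and c :: int
  assumes g: "g \<ge> 1" and r: "10 * g \<le> r + 1"
  shows "(\<Sum>p\<in>{p. b ^ (4 * g + 1 + r) \<le> p \<and> p < b ^ (4 * g + 2 + r) \<and> coprime p b}.
      card {(\<rho>, x). \<rho> < b ^ (3 * g) \<and> x < b ^ (4 * g + r) \<and>
        (int p)\<^sup>2 dvd c + int (b ^ K * (\<rho> + b ^ (15 * g + 2 * r + 1) * rev_digits b (3 * g) \<rho> +
          b ^ (5 * g) * pal b (4 * g + r) x))}) \<le> 6 * b ^ (6 * g + r + 3)"
    (is "(\<Sum>p\<in>?P. _) \<le> _")
proof -
  define q where "q = 4 * g + r"
  define y where "y = (\<lambda>(\<rho>, x). c + int (b ^ K * (\<rho> + b ^ (15 * g + 2 * r + 1) * rev_digits b (3 * g) \<rho> +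
          b ^ (5 * g) * pal b q x)))"
  define S where "S p = {(\<rho>, x). \<rho> < b ^ (3 * g) \<and> x < b ^ q \<and> (int p)\<^sup>2 dvd y (\<rho>, x)}" for p
  define H where "H D E = {p. b ^ (4 * g + 1 + r) \<le> p \<and> p < b ^ (4 * g + 2 + r) \<and> coprime p b \<and>
      (\<exists>e. \<bar>e\<bar> < int (b ^ (4 * g + 2 * r + 1)) \<and>
         (int p)\<^sup>2 dvd D + int (b ^ (15 * g + 2 * r + 1) * E) + int (b ^ (7 * g)) * e)}"
    for D :: int and E
  define R where "R = {(\<rho>, \<rho>'). \<rho> < b ^ (3 * g) \<and> \<rho>' < b ^ (3 * g) \<and> rev_digits b (3 * g) \<rho>' < rev_digits b (3 * g) \<rho>}"
  define HR where "HR = (\<lambda>(\<rho>, \<rho>'). H (int \<rho> - int \<rho>') (rev_digits b (3 * g) \<rho> - rev_digits b (3 * g) \<rho>'))"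
  have finP: "finite ?P" by (rule finite_subset[of _ "{..<b ^ (4 * g + 2 + r)}"]) auto
  have R_sub: "R \<subseteq> {..<b ^ (3 * g)} \<times> {..<b ^ (3 * g)}" by (auto simp: R_def)
  have finR: "finite R" using R_sub by (rule finite_subset) auto
  have cardR: "card R \<le> b ^ (6 * g)"
    using card_mono[OF _ R_sub] by (simp flip: power_add)
  have finS: "finite (S p)" for p
    by (rule finite_subset[of _ "{..<b ^ (3 * g)} \<times> {..<b ^ q}"]) (auto simp: S_def)
  have cancel: "(int p)\<^sup>2 dvd z" if "p \<in> ?P" "(int p)\<^sup>2 dvd int (b ^ k) * z" for p k z
  proof -
    have "coprime ((int p)\<^sup>2) (int (b ^ k))" using that(1) by (simp del: of_nat_power)
    then show ?thesis using that(2) by (simp only: coprime_dvd_mult_right_iff)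
  qed
  \<comment> \<open>subtracting two solutions removes \<open>c\<close>\<close>
  have diff: "(int p)\<^sup>2 dvd (int \<rho> - int \<rho>')
        + int (b ^ (15 * g + 2 * r + 1)) * (int (rev_digits b (3 * g) \<rho>) - int (rev_digits b (3 * g) \<rho>'))
        + int (b ^ (5 * g)) * (int (pal b q x) - int (pal b q x'))"
    if p: "p \<in> ?P" and "(\<rho>, x) \<in> S p" "(\<rho>', x') \<in> S p" for p \<rho> x \<rho>' x'
  proof -
    have "(int p)\<^sup>2 dvd y (\<rho>, x) - y (\<rho>', x')" using that by (intro dvd_diff) (auto simp: S_def)
    also have "y (\<rho>, x) - y (\<rho>', x') = int (b ^ K) * ((int \<rho> - int \<rho>')
        + int (b ^ (15 * g + 2 * r + 1)) * (int (rev_digits b (3 * g) \<rho>) - int (rev_digits b (3 * g) \<rho>'))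
        + int (b ^ (5 * g)) * (int (pal b q x) - int (pal b q x')))"
      by (simp add: y_def algebra_simps)
    finally show ?thesis by (rule cancel[OF p])
  qed
  \<comment> \<open>the central palindrome has \<open>2q + 1 = 2s - 1\<close> digits, hence is smaller than \<open>p\<^sup>2\<close>\<close>
  have fst_inj: "inj_on fst (S p)" if p: "p \<in> ?P" for p
  proof (rule inj_onI, clarify)
    fix \<rho> x \<rho>' x' assume S: "(\<rho>, x) \<in> S p" "(\<rho>', x') \<in> S p" "fst (\<rho>, x) = fst (\<rho>', x')"
    then have \<rho>: "\<rho> = \<rho>'" by simp
    have "(int p)\<^sup>2 dvd int (b ^ (5 * g)) * (int (pal b q x) - int (pal b q x'))"
      using diff[OF p S(1,2)] \<rho> by simp
    then have dvd: "(int p)\<^sup>2 dvd int (pal b q x) - int (pal b q x')" by (rule cancel[OF p])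
    have x: "x < b ^ q" "x' < b ^ q" using S by (auto simp: S_def)
    have "b ^ (2 * q + 1) \<le> (b ^ (4 * g + 1 + r))\<^sup>2"
      unfolding power_mult [symmetric] using b2 by (intro power_increasing) (auto simp: q_def)
    also have "\<dots> \<le> p\<^sup>2" using p by (intro power_mono) auto
    finally have "pal b q x < p\<^sup>2" "pal b q x' < p\<^sup>2"
      using pal_less[OF b2] x by (meson less_le_trans)+
    then have "int (pal b q x) < (int p)\<^sup>2" "int (pal b q x') < (int p)\<^sup>2"
      by (simp_all only: of_nat_less_iff flip: of_nat_power)
    then have "\<bar>int (pal b q x) - int (pal b q x')\<bar> < (int p)\<^sup>2" by linarith
    with dvd have "pal b q x = pal b q x'" using zdvd_not_zless[of "\<bar>int (pal b q x) - int (pal b q x')\<bar>"]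
      by (metis abs_of_nonneg dvd_abs_iff eq_iff_diff_eq_0 of_nat_eq_iff zero_less_abs_iff)
    then have "x = x'" using pal_inj[OF b2 x] by blast
    with \<rho> show "\<rho> = \<rho>' \<and> x = x'" by blast
  qed
  have card_S: "card (S p) \<le> b ^ (2 * g) + card {z \<in> R. p \<in> HR z}" if p: "p \<in> ?P" for p
  proof -
    define w where "w = (\<lambda>z::nat \<times> nat. rev_digits b (3 * g) (fst z))"
    define t where "t = (\<lambda>z::nat \<times> nat. snd z mod b ^ (2 * g))"
    define Q where "Q = {(z, z') \<in> S p \<times> S p. t z = t z' \<and> w z' < w z}"
    have w_inj: "inj_on w (S p)"
    proof (rule inj_onI)
      fix z z' assume z: "z \<in> S p" "z' \<in> S p" "w z = w z'"
      then have "fst z = fst z'"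
        by (intro rev_digits_inj[OF b2, of "fst z" "3 * g" "fst z'"]) (auto simp: w_def S_def)
      with z show "z = z'" using fst_inj[OF p] by (meson inj_onD)
    qed
    have "card (S p) \<le> b ^ (2 * g) + card Q"
      unfolding Q_def using b2 by (intro card_le_classes_plus_pairs finS w_inj) (auto simp: t_def)
    also have "card Q \<le> card {z \<in> R. p \<in> HR z}"
    proof (rule card_inj_on_le[of "map_prod fst fst"])
      have "inj_on (map_prod fst fst) (S p \<times> S p)"
        using fst_inj[OF p] by (intro map_prod_inj_on)
      then show "inj_on (map_prod fst fst) Q"
        by (rule inj_on_subset) (auto simp: Q_def)
      show "finite {z \<in> R. p \<in> HR z}" using finR by simp
      show "map_prod fst fst ` Q \<subseteq> {z \<in> R. p \<in> HR z}"
      proof (rule image_subsetI)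
        fix z assume Q: "z \<in> Q"
        obtain \<rho> x \<rho>' x' where z: "z = ((\<rho>, x), (\<rho>', x'))" by (metis prod.collapse)
        from Q have S: "(\<rho>, x) \<in> S p" "(\<rho>', x') \<in> S p"
          and wless: "rev_digits b (3 * g) \<rho>' < rev_digits b (3 * g) \<rho>" and t: "x mod b ^ (2 * g) = x' mod b ^ (2 * g)"
          by (auto simp: Q_def w_def t_def z)
        have R: "(\<rho>, \<rho>') \<in> R" using S wless by (auto simp: R_def S_def)
        \<comment> \<open>in a common class the outermost \<open>2g\<close> digits of \<open>x\<close> cancel and the difference gains the factor \<open>b\<^sup>2\<^sup>g\<close>\<close>
        define l where "l = 2 * g + r"
        have q: "q = 2 * g + l" by (simp add: q_def l_def)
        define e where "e = int (pal b l (x div b ^ (2 * g))) - int (pal b l (x' div b ^ (2 * g)))"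
        have pal_less': "int (pal b l (z div b ^ (2 * g))) < int (b ^ (2 * l + 1))" if "z < b ^ q" for z
        proof -
          have "z div b ^ (2 * g) < b ^ l"
            using that by (simp add: q power_add less_mult_imp_div_less mult.commute)
          then show ?thesis using pal_less[OF b2] by (simp only: of_nat_less_iff)
        qed
        have "int (pal b l (x div b ^ (2 * g))) < int (b ^ (2 * l + 1))"
          "int (pal b l (x' div b ^ (2 * g))) < int (b ^ (2 * l + 1))"
          using S pal_less'[of x] pal_less'[of x'] unfolding S_def by blast+
        moreover have "2 * l + 1 = 4 * g + 2 * r + 1" by (simp add: l_def)
        ultimately have e: "\<bar>e\<bar> < int (b ^ (4 * g + 2 * r + 1))"
          unfolding e_def by (simp only: abs_less_iff) linarith
        have pal_split: "pal b q z = (z mod b ^ (2 * g)) + b ^ (2 * g + 2 * l + 1) * rev_digits b (2 * g) (z mod b ^ (2 * g))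
            + b ^ (2 * g) * pal b l (z div b ^ (2 * g))" for z
          using pal_append[OF b2, of "z mod b ^ (2 * g)" "2 * g" l "z div b ^ (2 * g)"] b2 by (simp add: q)
        have "int (pal b q x) - int (pal b q x') = int (b ^ (2 * g)) * e"
          unfolding pal_split[of x] pal_split[of x'] t by (simp add: e_def algebra_simps)
        then have "int (b ^ (5 * g)) * (int (pal b q x) - int (pal b q x')) = int (b ^ (7 * g)) * e"
          by (simp flip: mult.assoc power_add)
        then have "(int p)\<^sup>2 dvd (int \<rho> - int \<rho>')
            + int (b ^ (15 * g + 2 * r + 1) * (rev_digits b (3 * g) \<rho> - rev_digits b (3 * g) \<rho>')) + int (b ^ (7 * g)) * e"
          using diff[OF p S] wless by (simp add: of_nat_diff)
        then have "p \<in> HR (\<rho>, \<rho>')" unfolding HR_def H_def using p e by auto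
        with R show "map_prod fst fst z \<in> {z \<in> R. p \<in> HR z}"
          by (simp add: z)
      qed
    qed
    finally show ?thesis by simp
  qed
  have card_HR: "card (HR z) \<le> b ^ (10 * g) + 4 * b ^ (r + 3)" if "z \<in> R" for z
  proof -
    obtain \<rho> \<rho>' where z: "z = (\<rho>, \<rho>')" by force
    let ?E = "rev_digits b (3 * g) \<rho> - rev_digits b (3 * g) \<rho>'"
    have "card (H (int \<rho> - int \<rho>') ?E) \<le> b ^ (7 * g) * ?E + 4 * b ^ (r + 3)"
      unfolding H_def using that g
      by (intro card_near_square_divisors) (auto simp: R_def z abs_less_iff simp flip: of_nat_power)
    also have "b ^ (7 * g) * ?E \<le> b ^ (7 * g) * b ^ (3 * g)"
      using rev_digits_less[OF b2, of "3 * g" \<rho>] by (intro mult_left_mono) auto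
    also have "b ^ (7 * g) * b ^ (3 * g) = b ^ (10 * g)" by (simp flip: power_add)
    finally show ?thesis by (simp add: HR_def z)
  qed
  have "(\<Sum>p\<in>?P. card (S p)) \<le> (\<Sum>p\<in>?P. b ^ (2 * g) + card {z \<in> R. p \<in> HR z})"
    by (intro sum_mono card_S)
  also have "\<dots> = card ?P * b ^ (2 * g) + (\<Sum>z\<in>R. card {p \<in> ?P. p \<in> HR z})"
    unfolding sum.distrib sum_swap_card[OF finP finR] by simp
  also have "card ?P \<le> b ^ (4 * g + 2 + r)"
    using card_mono[of "{..<b ^ (4 * g + 2 + r)}" ?P] by fastforce
  also have "(\<Sum>z\<in>R. card {p \<in> ?P. p \<in> HR z}) \<le> (\<Sum>z\<in>R. b ^ (10 * g) + 4 * b ^ (r + 3))"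
  proof (intro sum_mono order.trans[OF card_mono card_HR])
    fix z show "finite (HR z)"
      by (rule finite_subset[of _ "{..<b ^ (4 * g + 2 + r)}"]) (auto simp: HR_def H_def split: prod.splits)
  qed auto
  also have "(\<Sum>z\<in>R. b ^ (10 * g) + 4 * b ^ (r + 3)) \<le> b ^ (6 * g) * (b ^ (10 * g) + 4 * b ^ (r + 3))"
    unfolding sum_constant using cardR by (intro mult_right_mono) auto
  also have "b ^ (6 * g) * (b ^ (10 * g) + 4 * b ^ (r + 3)) = b ^ (16 * g) + 4 * b ^ (6 * g + r + 3)"
    by (simp add: distrib_left add.assoc flip: power_add)
  also have "b ^ (16 * g) \<le> b ^ (6 * g + r + 3)" using r b2 by (intro power_increasing) auto
  also have "b ^ (4 * g + 2 + r) * b ^ (2 * g) \<le> b ^ (6 * g + r + 3)"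
    unfolding power_add [symmetric] using b2 by (intro power_increasing) auto
  finally show ?thesis by (simp add: S_def y_def q_def)
qed

text \<open>The lower half consists, from the outside to the inside, of \<open>K\<close> digits \<open>u\<close>, \<open>3g\<close> digits \<open>\<rho>\<close>, \<open>2g\<close>
  digits \<open>\<gamma>\<close> and \<open>4g + r\<close> digits \<open>x\<close>. For each of the \<open>b\<^sup>K\<^sup>+\<^sup>2\<^sup>g\<close> choices of \<open>u\<close> and \<open>\<gamma>\<close>
  the preceding lemma applies. In terms of \<open>h\<close> the exponent on the right is \<open>h - g + 3\<close>.\<close>

lemma sum_card_square_divisors_middle:
  fixes g r K h :: nat
  assumes g: "g \<ge> 1" and r: "10 * g \<le> r + 1" and h: "h = K + 9 * g + r"
  shows "(\<Sum>p\<in>{p. b ^ (4 * g + 1 + r) \<le> p \<and> p < b ^ (4 * g + 2 + r) \<and> coprime p b}.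
      card {a. a < b ^ h \<and> p\<^sup>2 dvd pal b h a}) \<le> 6 * b ^ (K + 8 * g + r + 3)"
    (is "(\<Sum>p\<in>?P. _) \<le> _")
proof -
  define q where "q = 4 * g + r"
  define l2 where "l2 = 2 * g + q"
  define l3 where "l3 = 3 * g + l2"
  have h': "h = K + l3" by (simp add: h l3_def l2_def q_def)
  define c where "c = (\<lambda>(u, \<gamma>). u + b ^ (K + 2 * l3 + 1) * rev_digits b K u +
    b ^ K * (b ^ (3 * g) * (\<gamma> + b ^ (2 * g + 2 * q + 1) * rev_digits b (2 * g) \<gamma>)))"
  define S where "S = (\<lambda>p z. {(\<rho>, x). \<rho> < b ^ (3 * g) \<and> x < b ^ q \<and>
    (int p)\<^sup>2 dvd int (c z) + int (b ^ K * (\<rho> + b ^ (15 * g + 2 * r + 1) * rev_digits b (3 * g) \<rho> + b ^ (5 * g) * pal b q x))})"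
  define U where "U = {..<b ^ K} \<times> {..<b ^ (2 * g)}"
  define glue where "glue = (\<lambda>((u, \<gamma>), (\<rho>, x)). u + b ^ K * (\<rho> + b ^ (3 * g) * (\<gamma> + b ^ (2 * g) * x)))"
  have finS: "finite (S p z)" for p z
    by (rule finite_subset[of _ "{..<b ^ (3 * g)} \<times> {..<b ^ q}"]) (auto simp: S_def)
  have finU: "finite U" by (simp add: U_def)
  have split: "card {a. a < b ^ h \<and> p\<^sup>2 dvd pal b h a} \<le> (\<Sum>z\<in>U. card (S p z))" for p
  proof -
    have "{a. a < b ^ h \<and> p\<^sup>2 dvd pal b h a} \<subseteq> glue ` (SIGMA z:U. S p z)"
    proof clarify
      fix a assume a: "a < b ^ h" and dvd: "p\<^sup>2 dvd pal b h a"
      define u where "u = a mod b ^ K"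
      define a1 where "a1 = a div b ^ K"
      define \<rho> where "\<rho> = a1 mod b ^ (3 * g)"
      define a2 where "a2 = a1 div b ^ (3 * g)"
      define \<gamma> where "\<gamma> = a2 mod b ^ (2 * g)"
      define x where "x = a2 div b ^ (2 * g)"
      have lts: "u < b ^ K" "\<rho> < b ^ (3 * g)" "\<gamma> < b ^ (2 * g)"
        using b2 by (simp_all add: u_def \<rho>_def \<gamma>_def)
      have "a1 < b ^ l3" using a by (simp add: a1_def h' power_add less_mult_imp_div_less mult.commute)
      then have "a2 < b ^ l2" by (simp add: a2_def l3_def power_add less_mult_imp_div_less mult.commute)
      then have x: "x < b ^ q" by (simp add: x_def l2_def power_add less_mult_imp_div_less mult.commute)
      have eqs: "a = u + b ^ K * a1" "a1 = \<rho> + b ^ (3 * g) * a2" "a2 = \<gamma> + b ^ (2 * g) * x"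
        by (simp_all add: u_def a1_def \<rho>_def a2_def \<gamma>_def x_def)
      have "pal b h a = u + b ^ (K + 2 * l3 + 1) * rev_digits b K u + b ^ K * pal b l3 a1"
        unfolding eqs(1) h' by (rule pal_append[OF b2 lts(1)])
      also have "pal b l3 a1 = \<rho> + b ^ (3 * g + 2 * l2 + 1) * rev_digits b (3 * g) \<rho> + b ^ (3 * g) * pal b l2 a2"
        unfolding eqs(2) l3_def by (rule pal_append[OF b2 lts(2)])
      also have "pal b l2 a2 = \<gamma> + b ^ (2 * g + 2 * q + 1) * rev_digits b (2 * g) \<gamma> + b ^ (2 * g) * pal b q x"
        unfolding eqs(3) l2_def by (rule pal_append[OF b2 lts(3)])
      also have "3 * g + 2 * l2 + 1 = 15 * g + 2 * r + 1" by (simp add: l2_def q_def)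
      finally have "pal b h a = c (u, \<gamma>) + b ^ K * (\<rho> + b ^ (15 * g + 2 * r + 1) * rev_digits b (3 * g) \<rho> +
          (b ^ (3 * g) * b ^ (2 * g)) * pal b q x)"
        unfolding c_def by (simp add: algebra_simps)
      also have "b ^ (3 * g) * b ^ (2 * g) = b ^ (5 * g)" by (simp flip: power_add)
      finally have "int (pal b h a) = int (c (u, \<gamma>)) + int (b ^ K * (\<rho> + b ^ (15 * g + 2 * r + 1) * rev_digits b (3 * g) \<rho> +
          b ^ (5 * g) * pal b q x))" by simp
      moreover have "(int p)\<^sup>2 dvd int (pal b h a)" using dvd by (simp only: of_nat_dvd_iff flip: of_nat_power)
      ultimately have "((u, \<gamma>), (\<rho>, x)) \<in> (SIGMA z:U. S p z)"
        using lts x unfolding S_def U_def by simp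
      moreover have "a = glue ((u, \<gamma>), (\<rho>, x))" using eqs by (simp add: glue_def)
      ultimately show "a \<in> glue ` (SIGMA z:U. S p z)" by blast
    qed
    then have "card {a. a < b ^ h \<and> p\<^sup>2 dvd pal b h a} \<le> card (SIGMA z:U. S p z)"
      using finU finS by (intro surj_card_le) auto
    also have "\<dots> = (\<Sum>z\<in>U. card (S p z))" using finU finS by (intro card_SigmaI) auto
    finally show ?thesis .
  qed
  have "(\<Sum>p\<in>?P. card {a. a < b ^ h \<and> p\<^sup>2 dvd pal b h a}) \<le> (\<Sum>p\<in>?P. \<Sum>z\<in>U. card (S p z))"
    by (intro sum_mono split)
  also have "\<dots> = (\<Sum>z\<in>U. \<Sum>p\<in>?P. card (S p z))" by (rule sum.swap)
  also have "\<dots> \<le> (\<Sum>z\<in>U. 6 * b ^ (6 * g + r + 3))"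
    unfolding S_def q_def by (intro sum_mono sum_card_inner_solutions g r)
  also have "\<dots> = 6 * ((b ^ K * b ^ (2 * g)) * b ^ (6 * g + r + 3))"
    by (simp add: U_def)
  also have "(b ^ K * b ^ (2 * g)) * b ^ (6 * g + r + 3) = b ^ (K + 8 * g + r + 3)"
    unfolding power_add [symmetric] by (rule arg_cong[where f = "(^) b"]) simp
  finally show ?thesis .
qed

end

section \<open>Squares of large numbers\<close>

context
  fixes b :: nat
  assumes b2: "b \<ge> 2"
begin

text \<open>The map sending \<open>(p, a)\<close> to \<open>(p mod b\<^sup>L, n / p\<^sup>2)\<close>, where \<open>n\<close> is the palindrome of \<open>a\<close>, is
  injective. If \<open>p < p\<^sub>1\<close> had the same image, the two palindromes would agree in the last and hence in the first
  \<open>L\<close> digits, so they would differ by less than \<open>b\<^sup>2\<^sup>h\<^sup>+\<^sup>1\<^sup>-\<^sup>L\<close>, while \<open>p\<^sub>1 - p \<ge> b\<^sup>L\<close> forces a larger difference.\<close>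

lemma sum_card_square_divisors_large:
  fixes h s L :: nat
  assumes h: "h > 0" and s: "s \<le> h" and L: "s + 2 \<le> 2 * L" "L \<le> h"
  shows "(\<Sum>p\<in>{b ^ s..<b ^ Suc s}. card {a. a < b ^ h \<and> a mod b = 1 \<and> p\<^sup>2 dvd pal b h a})
    \<le> b ^ L * b ^ (2 * h + 1 - 2 * s)"
proof -
  define A where "A p = {a. a < b ^ h \<and> a mod b = 1 \<and> p\<^sup>2 dvd pal b h a}" for p
  define S where "S = (SIGMA p:{b ^ s..<b ^ Suc s}. A p)"
  define f where "f = (\<lambda>(p, a). (p mod b ^ L, pal b h a div p\<^sup>2))"
  obtain l where l: "h = L + l" using L(2) le_Suc_ex by blast
  have no_less: "\<not> p < p'"
    if pa: "(p, a) \<in> S" "(p', a') \<in> S" and eq: "f (p, a) = f (p', a')" for p a p' a'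
  proof
    assume less: "p < p'"
    define m where "m = pal b h a div p\<^sup>2"
    have "m = pal b h a' div p'\<^sup>2" using eq by (simp add: f_def m_def)
    moreover have "p\<^sup>2 dvd pal b h a" "p'\<^sup>2 dvd pal b h a'" using pa by (simp_all add: S_def A_def)
    ultimately have n: "pal b h a = p\<^sup>2 * m" "pal b h a' = p'\<^sup>2 * m"
      unfolding m_def by (metis dvd_mult_div_cancel)+
    have pmod: "p mod b ^ L = p' mod b ^ L" using eq by (simp add: f_def)
    have parts: "pal b h a = a mod b ^ L + b ^ (L + 2 * l + 1) * rev_digits b L (a mod b ^ L) + b ^ L * pal b l (a div b ^ L)"
      for a using pal_append[OF b2, of "a mod b ^ L" L l "a div b ^ L"] b2 by (simp add: l)
    have "a mod b ^ L = a' mod b ^ L"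
    proof -
      have "pal b h c mod b ^ L = c mod b ^ L" for c
      proof -
        have "pal b h c = c mod b ^ L + b ^ L * (b ^ (2 * l + 1) * rev_digits b L (c mod b ^ L) + pal b l (c div b ^ L))"
          by (subst parts) (simp add: algebra_simps power_add)
        then show ?thesis by (simp only: mod_mult_self2) simp
      qed
      moreover have "p\<^sup>2 * m mod b ^ L = p'\<^sup>2 * m mod b ^ L"
        using pmod by (metis mod_mult_left_eq power_mod)
      ultimately show ?thesis using n by metis
    qed
    moreover have "pal b l (a' div b ^ L) < b ^ (2 * l + 1)"
      using pa(2) b2 by (intro pal_less) (auto simp: S_def A_def l power_add less_mult_imp_div_less mult.commute)
    then have "b ^ L * pal b l (a' div b ^ L) < b ^ L * b ^ (2 * l + 1)"
      using b2 by simp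
    then have "b ^ L * pal b l (a' div b ^ L) < b ^ (L + 2 * l + 1)"
      by (simp add: power_add mult.assoc)
    ultimately have lt: "p'\<^sup>2 * m < p\<^sup>2 * m + b ^ (L + 2 * l + 1)"
      unfolding n [symmetric] by (subst (1 2) parts) simp
    have "b ^ L dvd p' - p" using mod_eq_dvd_iff_nat[of p p' "b ^ L"] pmod less by simp
    then have "b ^ L \<le> p' - p" using less by (intro dvd_imp_le) auto
    then have "p + b ^ L \<le> p'" using less by simp
    then have "(p + b ^ L)\<^sup>2 * m \<le> p'\<^sup>2 * m" by (intro mult_right_mono power_mono) auto
    moreover have "p\<^sup>2 * m + b ^ L * p * m \<le> (p + b ^ L)\<^sup>2 * m"
      by (simp add: power2_eq_square algebra_simps)
    ultimately have lt2: "b ^ L * p * m < b ^ (L + 2 * l + 1)" using lt by linarith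
    have "b ^ (2 * h) \<le> p\<^sup>2 * m"
      using pal_ge[OF b2 h, of a] pa(1) n by (auto simp: S_def A_def)
    then have "b ^ L * b ^ (2 * h) \<le> (b ^ L * p * m) * p" by (simp add: power2_eq_square mult_ac)
    also have "\<dots> \<le> (b ^ L * p * m) * b ^ Suc s"
      using pa(1) by (intro mult_left_mono) (auto simp: S_def)
    also have "\<dots> < b ^ (L + 2 * l + 1) * b ^ Suc s"
      using lt2 b2 by (intro mult_strict_right_mono) auto
    finally have "b ^ L * b ^ (2 * h) < b ^ (L + 2 * l + 1) * b ^ Suc s" .
    then have "b ^ (L + 2 * h) < b ^ (L + 2 * l + 1 + Suc s)" by (simp only: power_add)
    moreover have "1 < b" using b2 by simp
    ultimately have "L + 2 * h < L + 2 * l + 1 + Suc s" by (rule power_less_imp_less_exp[rotated])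
    with L(1) show False by (simp add: l)
  qed
  have "inj_on f S"
  proof (rule inj_onI, clarify)
    fix p a p' a' assume pa: "(p, a) \<in> S" "(p', a') \<in> S" "f (p, a) = f (p', a')"
    then have "p = p'" using no_less[of p a p' a'] no_less[of p' a' p a] by (metis linorder_neqE_nat)
    moreover from this have "pal b h a = pal b h a'"
      using pa by (auto simp: S_def A_def f_def intro: dvd_div_eq_cancel)
    then have "a = a'" using pa by (intro pal_inj[OF b2, of a h a']) (auto simp: S_def A_def)
    ultimately show "p = p' \<and> a = a'" by simp
  qed
  moreover have "f ` S \<subseteq> {..<b ^ L} \<times> {..<b ^ (2 * h + 1 - 2 * s)}"
  proof (rule image_subsetI)
    fix z assume "z \<in> S"
    moreover obtain q a where z: "z = (q, a)" by force
    ultimately have q: "b ^ s \<le> q" and a: "a < b ^ h" by (auto simp: S_def A_def)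
    have "b ^ (2 * h + 1) \<le> b ^ (2 * h + 1 - 2 * s) * (b ^ s)\<^sup>2"
      using s by (simp flip: power_mult power_add add: mult.commute)
    also have "\<dots> \<le> b ^ (2 * h + 1 - 2 * s) * q\<^sup>2"
      using q by (intro mult_left_mono power_mono) auto
    finally have "pal b h a < b ^ (2 * h + 1 - 2 * s) * q\<^sup>2"
      using pal_less[OF b2 a] by simp
    then have "pal b h a div q\<^sup>2 < b ^ (2 * h + 1 - 2 * s)"
      by (rule less_mult_imp_div_less)
    with b2 show "f z \<in> {..<b ^ L} \<times> {..<b ^ (2 * h + 1 - 2 * s)}"
      by (simp add: f_def z)
  qed
  ultimately have "card S \<le> card ({..<b ^ L} \<times> {..<b ^ (2 * h + 1 - 2 * s)})"
    by (intro card_inj_on_le) auto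
  moreover have "card S = (\<Sum>p\<in>{b ^ s..<b ^ Suc s}. card (A p))"
    unfolding S_def by (intro card_SigmaI) (auto simp: A_def)
  ultimately show ?thesis by (simp add: A_def)
qed

end

section \<open>Combining the three ranges\<close>

lemma sum_inverse_squares_le:
  "(\<Sum>d\<in>{3..<n + 3}. 1 / (real d)\<^sup>2) \<le> 1 / 2 - 1 / real (n + 2)"
proof (induction n)
  case (Suc n)
  have "1 / (real (n + 3))\<^sup>2 \<le> 1 / (real (n + 2) * real (n + 3))"
    by (intro divide_left_mono) (auto simp: power2_eq_square)
  also have "\<dots> = 1 / real (n + 2) - 1 / real (n + 3)"
    by (simp add: field_simps)
  finally have "1 / (real (n + 3))\<^sup>2 \<le> 1 / real (n + 2) - 1 / real (n + 3)" .
  moreover have "{3..<Suc n + 3} = insert (n + 3) {3..<n + 3}" by auto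
  ultimately show ?case using Suc by (simp add: add_ac)
qed simp

text \<open>Each block of \<open>14\<close> consecutive exponents \<open>s\<close> shares one value of \<open>g = s div 14\<close>.\<close>

lemma sum_half_powers_div_14:
  "(\<Sum>s\<in>{14 * G..<14 * (G + n)}. (1 / 2 :: real) ^ (s div 14)) = 28 * ((1 / 2) ^ G - (1 / 2) ^ (G + n))"
proof (induction n)
  case (Suc n)
  define m where "m = G + n"
  have "(\<Sum>s\<in>{14 * m..<14 * Suc m}. (1 / 2 :: real) ^ (s div 14)) = (\<Sum>s\<in>{14 * m..<14 * Suc m}. (1 / 2) ^ m)"
  proof (intro sum.cong refl)
    fix s assume "s \<in> {14 * m..<14 * Suc m}"
    then have "s div 14 = m" by auto
    then show "(1 / 2 :: real) ^ (s div 14) = (1 / 2) ^ m" by simp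
  qed
  also have "\<dots> = 28 * ((1 / 2) ^ m - (1 / 2) ^ Suc m)" by simp
  finally have "(\<Sum>s\<in>{14 * m..<14 * Suc m}. (1 / 2 :: real) ^ (s div 14)) = 28 * ((1 / 2) ^ m - (1 / 2) ^ Suc m)" .
  moreover have "(\<Sum>s\<in>{14 * G..<14 * (G + Suc n)}. (1 / 2 :: real) ^ (s div 14)) =
      (\<Sum>s\<in>{14 * G..<14 * m}. (1 / 2) ^ (s div 14)) + (\<Sum>s\<in>{14 * m..<14 * Suc m}. (1 / 2) ^ (s div 14))"
    by (subst sum.atLeastLessThan_concat) (auto simp: m_def)
  ultimately show ?case using Suc.IH by (simp add: m_def)
qed simp

lemma exp_beats_linear:
  assumes "(9::nat) \<le> w"
  shows "8 * (5 * w + 1) \<le> (2::nat) ^ w"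
  using assms by (induction w rule: dec_induct) auto

context
  fixes b :: nat
  assumes b2: "b \<ge> 2"
begin

text \<open>With \<open>Y = b\<^sup>h\<^sup>-\<^sup>1\<close> palindromes in the family, those divisible by some \<open>d\<^sup>2\<close> number at most \<open>5 Y / 8\<close> for
  \<open>d < b\<^sup>2\<^sup>1\<^sup>0\<close>, \<open>Y / 8\<close> for medium \<open>d\<close> and \<open>Y / 8\<close> for large \<open>d\<close>. The medium range starts at \<open>s = 210\<close>,
  that is \<open>g = 15\<close>, because its total contribution is at most \<open>96 \<cdot> 28 / 2\<^sup>1\<^sup>5 < 1 / 8\<close> of \<open>Y\<close>.\<close>

lemma eventually_ex_squarefree_pal:
  "\<forall>\<^sub>F w in sequentially. \<exists>a < b ^ (19 * w). a mod b = 1 \<and> squarefree (pal b (19 * w) a)"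
proof -
  define A where "A h d = {a. a < b ^ h \<and> a mod b = 1 \<and> d\<^sup>2 dvd pal b h a}" for h d
  define Ds where "Ds = {d \<in> {3..<b ^ 210}. odd d \<and> coprime b d}"
  \<comment> \<open>the fewer than \<open>b\<^sup>2\<^sup>1\<^sup>0\<close> error terms of the small range add up to at most \<open>1 / 8\<close>\<close>
  define \<epsilon> where "\<epsilon> = 1 / (8 * real b ^ 210)"
  have b0: "real b > 0" "real b \<ge> 2" using b2 by auto
  have "\<forall>\<^sub>F h in sequentially. \<forall>d\<in>Ds. real (card (A h d)) \<le> (1 / (real d)\<^sup>2 + \<epsilon>) * real b ^ (h - 1)"
    unfolding A_def using b2 
    by (intro eventually_ball_finite ballI card_square_divisors_small[OF b2]) (auto simp: Ds_def \<epsilon>_def)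
  then have "\<forall>\<^sub>F w in sequentially. \<forall>d\<in>Ds. real (card (A (19 * w) d)) \<le> (1 / (real d)\<^sup>2 + \<epsilon>) * real b ^ (19 * w - 1)"
    by (rule eventually_compose_filterlim) (intro mult_nat_left_at_top, simp)
  moreover have "\<forall>\<^sub>F w in sequentially. 15 \<le> (w::nat)" by (rule eventually_ge_at_top)
  ultimately show ?thesis
  proof eventually_elim
    case (elim w)
    define h where "h = 19 * w"
    define F where "F = {a. a < b ^ h \<and> a mod b = 1}"
    define Y where "Y = real b ^ (h - 1)"
    have Y0: "Y > 0" using b0 by (simp add: Y_def)
    have h0: "h > 0" using elim by (simp add: h_def)
    define P where "P s = {p. b ^ s \<le> p \<and> p < b ^ Suc s}" for s
    define Pc where "Pc s = {p \<in> P s. coprime p b}" for s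
    have finF: "finite F" unfolding F_def by simp
    have finA: "finite (A h d)" for d unfolding A_def by simp
    have finP: "finite (P s)" for s unfolding P_def by (rule finite_subset[of _ "{..<b ^ Suc s}"]) auto
    have finPc: "finite (Pc s)" for s unfolding Pc_def using finP by simp
    show ?case
    proof (rule ccontr)
      assume none: "\<not> ?case"
      have cover: "F \<subseteq> (\<Union>d\<in>Ds. A h d) \<union> ((\<Union>s\<in>{210..<14 * w}. \<Union>p\<in>Pc s. A h p) \<union>
          (\<Union>s\<in>{14 * w..h}. \<Union>p\<in>P s. A h p))"
      proof
        fix a assume a: "a \<in> F"
        then have "\<not> squarefree (pal b h a)" using none by (auto simp: F_def h_def)
        then obtain d where d: "d\<^sup>2 dvd pal b h a" "\<not> d dvd 1" by (auto simp: squarefree_def)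
        have aA: "a \<in> A h d" using a d by (simp add: F_def A_def)
        have d_dvd: "d dvd pal b h a" using d(1) by (metis dvd_trans dvd_triv_left power2_eq_square)
        have odd_n: "odd (pal b h a)" using a h0 by (intro odd_pal[OF b2]) (auto simp: F_def)
        then have odd_d: "odd d" using d_dvd by (meson dvd_trans)
        have cop: "coprime d b" using coprime_of_dvd_pal[OF b2 h0 _ d_dvd] a by (simp add: F_def)
        have "d \<noteq> 0" "d \<noteq> 1" "d \<noteq> 2" using odd_d d(2) by (metis even_zero, auto)
        then have d3: "d \<ge> 3" by linarith
        have pos: "pal b h a > 0" using odd_n by (cases "pal b h a") auto
        obtain s where s: "b ^ s \<le> d" "d < b ^ Suc s"
          using ex_power_ivl1[OF b2, of d] d3 by auto
        have "(b ^ s)\<^sup>2 \<le> d\<^sup>2" using s(1) by (rule power_mono) simp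
        also have "\<dots> \<le> pal b h a" using d(1) pos by (rule dvd_imp_le)
        also have "\<dots> < b ^ (2 * h + 1)" using a by (intro pal_less[OF b2]) (simp add: F_def)
        finally have "b ^ (2 * s) < b ^ (2 * h + 1)" by (simp add: power_even_eq)
        then have "2 * s < 2 * h + 1" using b2 power_less_imp_less_exp[of b "2 * s" "2 * h + 1"] by simp
        then have sh: "s \<le> h" by simp
        have dP: "d \<in> P s" "d \<in> Pc s" using s cop by (auto simp: P_def Pc_def)
        consider "d < b ^ 210" | "s \<ge> 210" "s < 14 * w" | "s \<ge> 14 * w"
          | "d \<ge> b ^ 210" "s < 210" by linarith
        then show "a \<in> (\<Union>d\<in>Ds. A h d) \<union> ((\<Union>s\<in>{210..<14 * w}. \<Union>p\<in>Pc s. A h p) \<union>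
          (\<Union>s\<in>{14 * w..h}. \<Union>p\<in>P s. A h p))"
        proof cases
          case 1
          then have "d \<in> Ds" using d3 odd_d cop by (simp add: Ds_def coprime_commute)
          with aA show ?thesis by blast
        next
          case 2
          then have "s \<in> {210..<14 * w}" by simp
          with aA dP show ?thesis by blast
        next
          case 3
          then have "s \<in> {14 * w..h}" using sh by simp
          with aA dP show ?thesis by blast
        next
          case 4
          then have "b ^ Suc s \<le> b ^ 210" using b2 by (intro power_increasing) auto
          with 4 s(2) show ?thesis by linarith
        qed
      qed
      have "card F \<le> card ((\<Union>d\<in>Ds. A h d) \<union> ((\<Union>s\<in>{210..<14 * w}. \<Union>p\<in>Pc s. A h p) \<union>
          (\<Union>s\<in>{14 * w..h}. \<Union>p\<in>P s. A h p)))"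
        using finA finP finPc by (intro card_mono cover) (auto simp: Ds_def)
      also have "\<dots> \<le> (\<Sum>d\<in>Ds. card (A h d)) + ((\<Sum>s\<in>{210..<14 * w}. \<Sum>p\<in>Pc s. card (A h p)) +
          (\<Sum>s\<in>{14 * w..h}. \<Sum>p\<in>P s. card (A h p)))"
      proof -
        have 1: "card (\<Union>d\<in>Ds. A h d) \<le> (\<Sum>d\<in>Ds. card (A h d))"
          by (intro card_UN_le) (simp add: Ds_def)
        have 2: "card (\<Union>s\<in>{210..<14 * w}. \<Union>p\<in>Pc s. A h p) \<le> (\<Sum>s\<in>{210..<14 * w}. \<Sum>p\<in>Pc s. card (A h p))"
          by (intro order.trans[OF card_UN_le] sum_mono card_UN_le finPc) simp
        have 3: "card (\<Union>s\<in>{14 * w..h}. \<Union>p\<in>P s. A h p) \<le> (\<Sum>s\<in>{14 * w..h}. \<Sum>p\<in>P s. card (A h p))"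
          by (intro order.trans[OF card_UN_le] sum_mono card_UN_le finP) simp
        show ?thesis
          by (intro order.trans[OF card_Un_le] add_mono 1 2 3)
      qed
      finally have total: "real (card F) \<le> real (\<Sum>d\<in>Ds. card (A h d)) +
          (real (\<Sum>s\<in>{210..<14 * w}. \<Sum>p\<in>Pc s. card (A h p)) +
           real (\<Sum>s\<in>{14 * w..h}. \<Sum>p\<in>P s. card (A h p)))"
        unfolding of_nat_add [symmetric] of_nat_le_iff .
      have "b ^ (h - 1) \<le> card F"
      proof -
        have "inj_on (\<lambda>x. 1 + b * x) {..<b ^ (h - 1)}" using b2 by (auto simp: inj_on_def)
        moreover have "(\<lambda>x. 1 + b * x) ` {..<b ^ (h - 1)} \<subseteq> F"
        proof (rule image_subsetI)
          fix x assume "x \<in> {..<b ^ (h - 1)}"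
          then have "1 + b * x < b * (x + 1)" "x + 1 \<le> b ^ (h - 1)" using b2 by auto
          then have "1 + b * x < b * b ^ (h - 1)" by (meson less_le_trans mult_le_mono2)
          also have "\<dots> = b ^ h" using h0 by (simp add: power_eq_if)
          finally have "1 + b * x < b ^ h" .
          moreover have "(1 + b * x) mod b = 1" unfolding mod_mult_self2 using b2 by simp
          ultimately show "1 + b * x \<in> F" unfolding F_def by blast
        qed
        ultimately have "card {..<b ^ (h - 1)} \<le> card F" using finF by (intro card_inj_on_le)
        then show ?thesis by simp
      qed
      then have lower: "Y \<le> real (card F)" unfolding Y_def by (simp flip: of_nat_power)
      have small: "real (\<Sum>d\<in>Ds. card (A h d)) \<le> (5 / 8) * Y"
      proof -
        have "real (\<Sum>d\<in>Ds. card (A h d)) \<le> (\<Sum>d\<in>Ds. (1 / (real d)\<^sup>2 + \<epsilon>) * Y)"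
          unfolding of_nat_sum using elim(1) by (intro sum_mono) (simp add: h_def Y_def)
        also have "\<dots> = ((\<Sum>d\<in>Ds. 1 / (real d)\<^sup>2) + real (card Ds) * \<epsilon>) * Y"
          by (simp add: sum.distrib flip: sum_distrib_right)
        also have "\<dots> \<le> (1 / 2 + 1 / 8) * Y"
        proof (intro mult_right_mono add_mono)
          have "(\<Sum>d\<in>Ds. 1 / (real d)\<^sup>2) \<le> (\<Sum>d\<in>{3..<b ^ 210 + 3}. 1 / (real d)\<^sup>2)"
            by (intro sum_mono2) (auto simp: Ds_def)
          also have "\<dots> \<le> 1 / 2 - 1 / real (b ^ 210 + 2)" by (rule sum_inverse_squares_le)
          also have "\<dots> \<le> 1 / 2" by simp
          finally show "(\<Sum>d\<in>Ds. 1 / (real d)\<^sup>2) \<le> 1 / 2" .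
          have "card Ds \<le> card {..<b ^ 210}" by (intro card_mono) (auto simp: Ds_def)
          then have "real (card Ds) \<le> real b ^ 210" by (simp flip: of_nat_power)
          then have "real (card Ds) * \<epsilon> \<le> real b ^ 210 * \<epsilon>"
            by (intro mult_right_mono) (auto simp: \<epsilon>_def)
          also have "\<dots> = 1 / 8" using b0 by (simp add: \<epsilon>_def)
          finally show "real (card Ds) * \<epsilon> \<le> 1 / 8" .
        qed (use Y0 in auto)
        finally show ?thesis by simp
      qed
      have middle: "real (\<Sum>s\<in>{210..<14 * w}. \<Sum>p\<in>Pc s. card (A h p)) \<le> (1 / 8) * Y"
      proof -
        have "real (\<Sum>p\<in>Pc s. card (A h p)) \<le> 96 * Y * (1 / 2) ^ (s div 14)"
          if s: "s \<in> {210..<14 * w}" for s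
        proof -
          define g where "g = s div 14"
          have g: "14 * g \<le> s" "15 \<le> g" "g < w" using s by (auto simp: g_def)
          define r where "r = s - 4 * g - 1"
          define K where "K = h - 9 * g - r"
          have s_eq: "s = 4 * g + 1 + r" using g by (simp add: r_def)
          have h_eq: "h = K + 9 * g + r" using g s by (simp add: K_def h_def s_eq)
          have "Pc s = {p. b ^ (4 * g + 1 + r) \<le> p \<and> p < b ^ (4 * g + 2 + r) \<and> coprime p b}"
            by (auto simp: Pc_def P_def s_eq)
          moreover have "card (A h p) \<le> card {a. a < b ^ h \<and> p\<^sup>2 dvd pal b h a}" for p
            unfolding A_def by (intro card_mono) auto
          ultimately have "(\<Sum>p\<in>Pc s. card (A h p)) \<le>
              (\<Sum>p\<in>{p. b ^ (4 * g + 1 + r) \<le> p \<and> p < b ^ (4 * g + 2 + r) \<and> coprime p b}.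
                card {a. a < b ^ h \<and> p\<^sup>2 dvd pal b h a})"
            by (simp add: sum_mono)
          also have "\<dots> \<le> 6 * b ^ (K + 8 * g + r + 3)"
            using g s_eq by (intro sum_card_square_divisors_middle[OF b2 _ _ h_eq]) auto
          finally have "real (\<Sum>p\<in>Pc s. card (A h p)) \<le> real (6 * b ^ (K + 8 * g + r + 3))"
            by (simp only: of_nat_le_iff)
          also have "\<dots> = 6 * real b ^ (K + 8 * g + r + 3)" by simp
          also have "\<dots> \<le> 6 * (16 * (1 / 2) ^ g * Y)"
          proof -
            have "2 ^ (g - 4) \<le> real b ^ (g - 4)" using b0 by (intro power_mono) auto
            then have "real b ^ (K + 8 * g + r + 3) * 2 ^ (g - 4) \<le> real b ^ (K + 8 * g + r + 3) * real b ^ (g - 4)"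
              by (intro mult_left_mono) auto
            also have "\<dots> = Y"
              unfolding Y_def power_add [symmetric] using g h_eq by (intro arg_cong[where f = "(^) (real b)"]) simp
            finally have "real b ^ (K + 8 * g + r + 3) \<le> Y / 2 ^ (g - 4)" by (simp add: field_simps)
            also have "\<dots> = 16 * (1 / 2) ^ g * Y"
              using g by (simp add: power_diff power_one_over field_simps)
            finally show ?thesis by linarith
          qed
          finally show ?thesis by (simp add: g_def mult_ac)
        qed
        then have "real (\<Sum>s\<in>{210..<14 * w}. \<Sum>p\<in>Pc s. card (A h p)) \<le>
            (\<Sum>s\<in>{210..<14 * w}. 96 * Y * (1 / 2) ^ (s div 14))"
          by (subst of_nat_sum) (intro sum_mono)
        also have "\<dots> = 96 * Y * (28 * ((1 / 2) ^ 15 - (1 / 2) ^ w))"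
          using sum_half_powers_div_14[of 15 "w - 15"] elim by (simp flip: sum_distrib_left)
        also have "\<dots> \<le> 96 * Y * (28 * (1 / 2) ^ 15)"
          using Y0 by (intro mult_left_mono) auto
        also have "\<dots> \<le> (1 / 8) * Y" using Y0 by (simp add: power_one_over)
        finally show ?thesis .
      qed
      have large: "real (\<Sum>s\<in>{14 * w..h}. \<Sum>p\<in>P s. card (A h p)) \<le> (1 / 8) * Y"
      proof -
        have "(\<Sum>p\<in>P s. card (A h p)) \<le> b ^ (17 * w + 2)" if s: "s \<in> {14 * w..h}" for s
        proof -
          define L where "L = (s + 3) div 2"
          have L: "s + 2 \<le> 2 * L" "2 * L \<le> s + 3" by (auto simp: L_def)
          have "P s = {b ^ s..<b ^ Suc s}" by (auto simp: P_def)
          then have "(\<Sum>p\<in>P s. card (A h p)) \<le> b ^ L * b ^ (2 * h + 1 - 2 * s)"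
            using sum_card_square_divisors_large[OF b2 h0, of s L] s L elim
            by (simp add: A_def h_def)
          also have "\<dots> \<le> b ^ (17 * w + 2)"
            unfolding power_add [symmetric] using s L b2 by (intro power_increasing) (auto simp: h_def)
          finally show ?thesis .
        qed
        then have "(\<Sum>s\<in>{14 * w..h}. \<Sum>p\<in>P s. card (A h p)) \<le> (\<Sum>s\<in>{14 * w..h}. b ^ (17 * w + 2))"
          by (rule sum_mono)
        also have "\<dots> = (5 * w + 1) * b ^ (17 * w + 2)" by (simp add: h_def)
        finally have "8 * (\<Sum>s\<in>{14 * w..h}. \<Sum>p\<in>P s. card (A h p)) \<le> 8 * ((5 * w + 1) * b ^ (17 * w + 2))"
          by (rule mult_le_mono2)
        also have "\<dots> = (8 * (5 * w + 1)) * b ^ (17 * w + 2)" by (simp only: mult.assoc)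
        also have "\<dots> \<le> b ^ w * b ^ (17 * w + 2)"
        proof (rule mult_right_mono)
          have "8 * (5 * w + 1) \<le> 2 ^ w" using elim by (intro exp_beats_linear) simp
          also have "2 ^ w \<le> b ^ w" using b2 by (intro power_mono) auto
          finally show "8 * (5 * w + 1) \<le> b ^ w" .
        qed simp
        also have "\<dots> \<le> b ^ (h - 1)"
          unfolding power_add [symmetric] using b2 elim by (intro power_increasing) (auto simp: h_def)
        finally have "real (8 * (\<Sum>s\<in>{14 * w..h}. \<Sum>p\<in>P s. card (A h p))) \<le> real (b ^ (h - 1))"
          by (simp only: of_nat_le_iff)
        then show ?thesis by (simp add: Y_def)
      qed
      from lower total small middle large Y0 show False by linarith
    qed
  qed
qed

end

theorem theorem1p1:
  fixes b :: nat
  assumes "b \<ge> 2"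
  shows "infinite {n :: nat. palindrome b n \<and> squarefree n}"
  unfolding infinite_nat_iff_unbounded
proof
  fix m :: nat
  from eventually_ex_squarefree_pal[OF assms] obtain W where
    W: "\<And>w. w \<ge> W \<Longrightarrow> \<exists>a < b ^ (19 * w). a mod b = 1 \<and> squarefree (pal b (19 * w) a)"
    unfolding eventually_sequentially by blast
  define h where "h = 19 * (W + m + 1)"
  obtain a where a: "a < b ^ h" "a mod b = 1" "squarefree (pal b h a)"
    using W[of "W + m + 1"] by (auto simp: h_def)
  have h: "h > 0" by (simp add: h_def)
  have "m < 2 * h" by (simp add: h_def)
  also have "2 * h < b ^ (2 * h)" using assms by (simp add: power_gt_expt)
  also have "\<dots> \<le> pal b h a" by (rule pal_ge[OF assms h a(2)])
  finally show "\<exists>n>m. n \<in> {n. palindrome b n \<and> squarefree n}"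
    using palindrome_pal[OF assms h a(1,2)] a(3) by blast
qed

end
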